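(* Let $k\ge 2$ be a fixed integer and let $n_1,\ldots,n_k$ be positive integers with $n_k=\min_{1\le i\le k} n_i$. Let $G\sim\mathcal{T}(n_1,\ldots,n_k)$. Then, with probability $1-o(1)$ as $n_k\to\infty$, it holds that $f_k(G)=s(G)-k+1$.
   Context: $\mathcal{T}(n_1,\ldots,n_k)$ denotes the probability space of $k$-partite tournaments obtained from the complete $k$-partite graph with vertex classes $V_1,\ldots,V_k$, $|V_i|=n_i$, by orienting each edge independently and uniformly at random. For a $k$-partite tournament $G$, $s(G)$ denotes the size of its smallest vertex class (so $s(G)=n_k$ here). A feedback arc set of a directed graph $G$ is a set of edges meeting every directed cycle of $G$ (viewed as a spanning subgraph of $G$). For an oriented graph $G$, $f_k(G)$ is the maximum integer $t$ such that every feedback arc set of $G$ contains $t$ pairwise vertex-disjoint copies of the transitive tournament on $k$ vertices (i.e. of an acyclic $k$-clique). *)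

theory Defs
  imports "HOL-Probability.Probability"
begin

(* Vertices of the complete k-partite graph with classes V_0,...,V_{k-1},
   |V_i| = n i.  Vertex (i,j) is the j-th vertex of class i. *)
definition kp_vertices :: "nat \<Rightarrow> (nat \<Rightarrow> nat) \<Rightarrow> (nat \<times> nat) set" where
  "kp_vertices k n = {(i, j). i < k \<and> j < n i}"

definition kp_tournaments :: "nat \<Rightarrow> (nat \<Rightarrow> nat) \<Rightarrow> ((nat \<times> nat) \<times> (nat \<times> nat)) set set" where
  "kp_tournaments k n =
     {A. A \<subseteq> {(u, v). u \<in> kp_vertices k n \<and> v \<in> kp_vertices k n \<and> fst u \<noteq> fst v} \<and>
         (\<forall>u\<in>kp_vertices k n. \<forall>v\<in>kp_vertices k n. fst u \<noteq> fst v \<longrightarrow>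
              ((u, v) \<in> A \<longleftrightarrow> (v, u) \<notin> A))}"

(* Random k-partite tournament T(n_0,...,n_{k-1}): each edge oriented independently
   and uniformly, i.e. the uniform distribution on all orientations. *)
definition random_kp_tournament :: "nat \<Rightarrow> (nat \<Rightarrow> nat) \<Rightarrow> ((nat \<times> nat) \<times> (nat \<times> nat)) set pmf" where
  "random_kp_tournament k n = pmf_of_set (kp_tournaments k n)"

definition dir_cycle :: "('v \<times> 'v) set \<Rightarrow> 'v list \<Rightarrow> bool" where
  "dir_cycle A cs \<longleftrightarrow> length cs \<ge> 2 \<and> distinct cs \<and>
     (\<forall>i < length cs. (cs ! i, cs ! ((i + 1) mod length cs)) \<in> A)"

definition feedback_arc_set :: "('v \<times> 'v) set \<Rightarrow> ('v \<times> 'v) set \<Rightarrow> bool" where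
  "feedback_arc_set A F \<longleftrightarrow> F \<subseteq> A \<and>
     (\<forall>cs. dir_cycle A cs \<longrightarrow>
        (\<exists>i < length cs. (cs ! i, cs ! ((i + 1) mod length cs)) \<in> F))"

definition has_disjoint_TTs :: "nat \<Rightarrow> ('v \<times> 'v) set \<Rightarrow> nat \<Rightarrow> bool" where
  "has_disjoint_TTs k F t \<longleftrightarrow>
     (\<exists>c :: nat \<Rightarrow> nat \<Rightarrow> 'v.
        inj_on (\<lambda>(a, j). c a j) ({..<t} \<times> {..<k}) \<and>
        (\<forall>a < t. \<forall>j < k. \<forall>j' < k. j < j' \<longrightarrow> (c a j, c a j') \<in> F))"

definition f_TT :: "nat \<Rightarrow> ('v \<times> 'v) set \<Rightarrow> nat" where
  "f_TT k A = (GREATEST t. \<forall>F. feedback_arc_set A F \<longrightarrow> has_disjoint_TTs k F t)"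

end

theory Submission
  imports Defs "HOL-Library.Transitive_Closure_Table" "HOL-Real_Asymp.Real_Asymp"
begin

text \<open>
  Upper bound: choose a class c and a different vertex b i of c for every other class i. Give the
  vertices of c the middle level and every vertex of class i a higher or lower level according to its
  edge with b i. The edges that do not increase the level form a feedback arc set without edges
  between b i and class i, so none of the k - 1 vertices b i lies in a k-clique of it.

  Lower bound: a feedback arc set contains all backward edges of some linear order. Keep only the
  first m vertices of each class, m being the size of the smallest class. With high probability
  there are no two sets of logarithmic size in different classes with all edges directed from one
  to the other, and any two vertices have many directed paths of length two through any other
  class. The first property shows, for every linear order, that the graph of backward edges has no
  bipartite hole of logarithmic size; the second that at most one vertex has few backward edges to a
  given class, so that after deleting k - 1 vertices from each class all backward degrees are large.
  Such a graph has a perfect tiling by transversal cliques. This is proved by absorption: reserve a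
  small set Z and give each transversal of Z an absorber; cover the few vertices with few
  neighbours in Z; tile greedily; cover the small rest using Z; absorb what remains of Z.
\<close>

section \<open>Random multipartite tournaments\<close>

type_synonym arc_set = "((nat \<times> nat) \<times> (nat \<times> nat)) set"

definition kp_arcs :: "nat \<Rightarrow> (nat \<Rightarrow> nat) \<Rightarrow> arc_set" where
  "kp_arcs k n = {(u, v). u \<in> kp_vertices k n \<and> v \<in> kp_vertices k n \<and> fst u \<noteq> fst v}"

lemma kp_arcs_swap: "(u, v) \<in> kp_arcs k n \<Longrightarrow> (v, u) \<in> kp_arcs k n"
  by (auto simp: kp_arcs_def)

lemma mem_kp_tournaments_iff:
  "A \<in> kp_tournaments k n \<longleftrightarrow>
    A \<subseteq> kp_arcs k n \<and> (\<forall>u v. (u, v) \<in> kp_arcs k n \<longrightarrow> ((u, v) \<in> A \<longleftrightarrow> (v, u) \<notin> A))"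
  unfolding kp_tournaments_def kp_arcs_def mem_Collect_eq case_prod_conv by (intro conj_cong) blast+

lemma kp_tournament_subset: "A \<in> kp_tournaments k n \<Longrightarrow> A \<subseteq> kp_arcs k n"
  and kp_tournament_asym: "A \<in> kp_tournaments k n \<Longrightarrow> (u, v) \<in> A \<Longrightarrow> (v, u) \<notin> A"
  and kp_tournament_total:
    "A \<in> kp_tournaments k n \<Longrightarrow> (u, v) \<in> kp_arcs k n \<Longrightarrow> (u, v) \<in> A \<or> (v, u) \<in> A"
  unfolding mem_kp_tournaments_iff by blast+

lemma finite_kp_vertices: "finite (kp_vertices k n)"
proof -
  have "kp_vertices k n = Sigma {..<k} (\<lambda>i. {..<n i})" unfolding kp_vertices_def by auto
  then show ?thesis by simp
qed

lemma finite_kp_tournaments: "finite (kp_tournaments k n)"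
proof (rule finite_subset)
  show "kp_tournaments k n \<subseteq> Pow (kp_vertices k n \<times> kp_vertices k n)"
    unfolding kp_tournaments_def by auto
qed (simp add: finite_kp_vertices)

lemma kp_tournaments_nonempty: "kp_tournaments k n \<noteq> {}"
proof -
  have "{(u, v) \<in> kp_arcs k n. fst u < fst v} \<in> kp_tournaments k n"
    unfolding mem_kp_tournaments_iff by (auto simp: kp_arcs_def)
  then show ?thesis by blast
qed

lemma set_random_kp_tournament: "set_pmf (random_kp_tournament k n) = kp_tournaments k n"
  unfolding random_kp_tournament_def
  by (rule set_pmf_of_set[OF kp_tournaments_nonempty finite_kp_tournaments])

abbreviation (input) kp_prob :: "nat \<Rightarrow> (nat \<Rightarrow> nat) \<Rightarrow> arc_set set \<Rightarrow> real" where
  "kp_prob k n \<equiv> measure_pmf.prob (random_kp_tournament k n)"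

definition reverse_edge :: "'v \<Rightarrow> 'v \<Rightarrow> ('v \<times> 'v) set \<Rightarrow> ('v \<times> 'v) set" where
  "reverse_edge u v A = sym_diff A {(u, v), (v, u)}"

lemma reverse_edge_involution: "reverse_edge u v (reverse_edge u v A) = A"
  unfolding reverse_edge_def by auto

lemma mem_reverse_edge_iff:
  "e \<in> reverse_edge u v A \<longleftrightarrow> (if e \<in> {(u, v), (v, u)} then e \<notin> A else e \<in> A)"
  unfolding reverse_edge_def by auto

lemma reverse_edge_in_kp_tournaments:
  assumes A: "A \<in> kp_tournaments k n" and uv: "(u, v) \<in> kp_arcs k n"
  shows "reverse_edge u v A \<in> kp_tournaments k n"
  unfolding mem_kp_tournaments_iff
proof (intro conjI allI impI)
  show "reverse_edge u v A \<subseteq> kp_arcs k n"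
    using kp_tournament_subset[OF A] uv kp_arcs_swap[OF uv] unfolding reverse_edge_def by blast
  fix x y assume "(x, y) \<in> kp_arcs k n"
  then have "(x, y) \<in> A \<longleftrightarrow> (y, x) \<notin> A" using A unfolding mem_kp_tournaments_iff by blast
  then show "(x, y) \<in> reverse_edge u v A \<longleftrightarrow> (y, x) \<notin> reverse_edge u v A"
    by (auto simp: mem_reverse_edge_iff)
qed

lemma map_pmf_reverse_edge:
  assumes "(u, v) \<in> kp_arcs k n"
  shows "map_pmf (reverse_edge u v) (random_kp_tournament k n) = random_kp_tournament k n"
proof -
  have "bij_betw (reverse_edge u v) (kp_tournaments k n) (kp_tournaments k n)"
    using reverse_edge_in_kp_tournaments[OF _ assms]
    by (intro bij_betw_byWitness[where f' = "reverse_edge u v"]) (auto simp: reverse_edge_involution)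
  then show ?thesis
    unfolding random_kp_tournament_def
    by (rule map_pmf_of_set_bij_betw[OF _ kp_tournaments_nonempty finite_kp_tournaments])
qed

lemma prob_Int_eq_half:
  assumes "map_pmf f p = p" and invariant: "\<And>x. f x \<in> E \<longleftrightarrow> x \<in> E"
    and swapped: "\<And>x. x \<in> set_pmf p \<Longrightarrow> f x \<in> H \<longleftrightarrow> x \<notin> H"
  shows "measure_pmf.prob p (E \<inter> H) = measure_pmf.prob p E / 2"
proof -
  have "measure_pmf.prob p (E \<inter> H) = measure_pmf.prob (map_pmf f p) (E \<inter> H)"
    using assms(1) by simp
  also have "\<dots> = measure_pmf.prob p (f -` (E \<inter> H))" by simp
  also have "\<dots> = measure_pmf.prob p (E - H)"
    using invariant swapped by (intro measure_prob_cong_0) (auto simp: set_pmf_iff)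
  finally have "measure_pmf.prob p (E \<inter> H) = measure_pmf.prob p (E - H)" .
  moreover have "E = (E \<inter> H) \<union> (E - H)" by blast
  then have "measure_pmf.prob p E = measure_pmf.prob p (E \<inter> H) + measure_pmf.prob p (E - H)"
    using measure_pmf.finite_measure_Union[of "E \<inter> H" p "E - H"] by auto
  ultimately show ?thesis by simp
qed

lemma prob_arc_eq_half:
  assumes "(u, v) \<in> kp_arcs k n" "\<And>A. reverse_edge u v A \<in> E \<longleftrightarrow> A \<in> E"
  shows "kp_prob k n (E \<inter> {A. (u, v) \<in> A}) = kp_prob k n E / 2"
  by (rule prob_Int_eq_half[OF map_pmf_reverse_edge[OF assms(1)] assms(2)])
    (simp add: mem_reverse_edge_iff)

lemma prob_arcs_subset:
  assumes "finite Q" "Q \<subseteq> kp_arcs k n" "Q \<inter> Q\<inverse> = {}"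
  shows "kp_prob k n {A. Q \<subseteq> A} = (1 / 2) ^ card Q"
  using assms
proof (induction Q rule: finite_induct)
  case empty
  then show ?case by simp
next
  case (insert e Q)
  obtain u v where e: "e = (u, v)" by (cases e)
  have uv: "(u, v) \<in> kp_arcs k n" "(u, v) \<notin> Q" "(v, u) \<notin> Q"
    using insert.prems insert.hyps(2) e by blast+
  have IH: "kp_prob k n {A. Q \<subseteq> A} = (1 / 2) ^ card Q"
    using insert.prems by (intro insert.IH) blast+
  have "{A. insert e Q \<subseteq> A} = {A. Q \<subseteq> A} \<inter> {A. (u, v) \<in> A}" using e by auto
  moreover have "reverse_edge u v A \<in> {A. Q \<subseteq> A} \<longleftrightarrow> A \<in> {A. Q \<subseteq> A}" for A
    using uv(2,3) unfolding reverse_edge_def by blast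
  ultimately show ?case using IH insert.hyps prob_arc_eq_half[OF uv(1)] by simp
qed

definition midpoints :: "('v \<times> 'v) set \<Rightarrow> 'v \<Rightarrow> 'v \<Rightarrow> 'v set" where
  "midpoints A v u = {w. (v, w) \<in> A \<and> (w, u) \<in> A}"

lemma prob_no_midpoints:
  assumes "finite W" "u \<noteq> v" "\<And>w. w \<in> W \<Longrightarrow> (v, w) \<in> kp_arcs k n \<and> (w, u) \<in> kp_arcs k n"
  shows "kp_prob k n {A. W \<inter> midpoints A v u = {}} = (3 / 4) ^ card W"
  using assms(1,3)
proof (induction W rule: finite_induct)
  case empty
  then show ?case by simp
next
  case (insert w W)
  let ?P = "kp_prob k n"
  let ?E = "{A. W \<inter> midpoints A v u = {}}"
  have arcs: "(v, w) \<in> kp_arcs k n" "(w, u) \<in> kp_arcs k n" using insert.prems by auto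
  have neq: "x \<noteq> u \<and> x \<noteq> v" if "x \<in> insert w W" for x
    using insert.prems[OF that] by (auto simp: kp_arcs_def)
  have "?P (?E \<inter> {A. (v, w) \<in> A}) = ?P ?E / 2"
    using insert.hyps(2) neq
    by (intro prob_arc_eq_half[OF arcs(1)]) (auto simp: midpoints_def mem_reverse_edge_iff)
  moreover have "?P ((?E \<inter> {A. (v, w) \<in> A}) \<inter> {A. (w, u) \<in> A}) = ?P (?E \<inter> {A. (v, w) \<in> A}) / 2"
    using insert.hyps(2) neq \<open>u \<noteq> v\<close>
    by (intro prob_arc_eq_half[OF arcs(2)]) (auto simp: midpoints_def mem_reverse_edge_iff)
  moreover have "?P (?E - (?E \<inter> {A. (v, w) \<in> A}) \<inter> {A. (w, u) \<in> A}) =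
      ?P ?E - ?P ((?E \<inter> {A. (v, w) \<in> A}) \<inter> {A. (w, u) \<in> A})"
    by (rule measure_pmf.finite_measure_Diff) auto
  moreover have "{A. insert w W \<inter> midpoints A v u = {}} =
      ?E - (?E \<inter> {A. (v, w) \<in> A}) \<inter> {A. (w, u) \<in> A}"
    by (auto simp: midpoints_def)
  ultimately have "?P {A. insert w W \<inter> midpoints A v u = {}} = 3 / 4 * ?P ?E" by simp
  then show ?case using insert by simp
qed

lemma card_subsets_of_size_le:
  assumes "finite S"
  shows "card {X. X \<subseteq> S \<and> card X = a} \<le> card S ^ a"
proof (cases "a \<le> card S")
  case True
  then show ?thesis using n_subsets[OF assms, of a] binomial_le_pow[of a "card S"] by simp
next
  case False
  then show ?thesis using n_subsets[OF assms, of a] by (simp add: binomial_eq_0)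
qed

lemma card_subsets_of_cosize_le:
  assumes "finite S" "d \<le> card S"
  shows "card {X. X \<subseteq> S \<and> card X = card S - d} \<le> card S ^ d"
  using n_subsets[OF assms(1), of "card S - d"] binomial_le_pow[OF assms(2)]
    binomial_symmetric[OF assms(2)] by simp

lemma prob_union_bound:
  assumes "finite I" "E \<subseteq> (\<Union>i\<in>I. F i)" "\<And>i. i \<in> I \<Longrightarrow> measure_pmf.prob p (F i) \<le> b"
  shows "measure_pmf.prob p E \<le> real (card I) * b"
proof -
  have "measure_pmf.prob p E \<le> measure_pmf.prob p (\<Union>i\<in>I. F i)"
    using assms(2) by (intro measure_pmf.finite_measure_mono) auto
  also have "\<dots> \<le> (\<Sum>i\<in>I. measure_pmf.prob p (F i))"
    using assms(1) by (intro measure_UNION_le) auto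
  also have "\<dots> \<le> real (card I) * b" using assms(3) by (rule sum_bounded_above)
  finally show ?thesis .
qed

lemma prob_card_midpoints_less_le:
  assumes "finite W" "u \<noteq> v" "\<And>w. w \<in> W \<Longrightarrow> (v, w) \<in> kp_arcs k n \<and> (w, u) \<in> kp_arcs k n"
    and d: "d \<le> card W"
  shows "kp_prob k n {A. card (W \<inter> midpoints A v u) < d} \<le> real (card W) ^ d * (3 / 4) ^ (card W - d)"
proof -
  let ?I = "{S. S \<subseteq> W \<and> card S = card W - d}"
  have "kp_prob k n {A. card (W \<inter> midpoints A v u) < d} \<le> real (card ?I) * (3 / 4) ^ (card W - d)"
  proof (rule prob_union_bound[where F = "\<lambda>S. {A. S \<inter> midpoints A v u = {}}"])
    show "{A. card (W \<inter> midpoints A v u) < d} \<subseteq> (\<Union>S\<in>?I. {A. S \<inter> midpoints A v u = {}})"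
    proof
      fix A assume "A \<in> {A. card (W \<inter> midpoints A v u) < d}"
      then have "card W - d \<le> card (W - midpoints A v u)"
        using assms(1) by (subst card_Diff_subset_Int) auto
      then obtain S where "S \<subseteq> W - midpoints A v u" "card S = card W - d"
        by (metis obtain_subset_with_card_n)
      then show "A \<in> (\<Union>S\<in>?I. {A. S \<inter> midpoints A v u = {}})" by blast
    qed
    show "kp_prob k n {A. S \<inter> midpoints A v u = {}} \<le> (3 / 4) ^ (card W - d)" if "S \<in> ?I" for S
    proof -
      have "finite S" using that assms(1) by (auto dest: finite_subset)
      then have "kp_prob k n {A. S \<inter> midpoints A v u = {}} = (3 / 4) ^ card S"
        using that assms(2,3) by (intro prob_no_midpoints) blast+
      then show ?thesis using that by simp
    qed
  qed (use assms(1) in simp)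
  also have "real (card ?I) \<le> real (card W) ^ d"
    using card_subsets_of_cosize_le[OF assms(1) d] by (simp flip: of_nat_power)
  finally show ?thesis by (simp add: mult_right_mono)
qed

lemma prob_all_arcs_between_subsets_le:
  assumes "finite S" "finite T" "S \<times> T \<subseteq> kp_arcs k n" "S \<inter> T = {}"
  shows "kp_prob k n {A. \<exists>X\<subseteq>S. \<exists>Y\<subseteq>T. card X = a \<and> card Y = a \<and> X \<times> Y \<subseteq> A}
    \<le> real (card S) ^ a * real (card T) ^ a * (1 / 2) ^ (a * a)"
proof -
  let ?I = "{X. X \<subseteq> S \<and> card X = a} \<times> {Y. Y \<subseteq> T \<and> card Y = a}"
  have "kp_prob k n {A. \<exists>X\<subseteq>S. \<exists>Y\<subseteq>T. card X = a \<and> card Y = a \<and> X \<times> Y \<subseteq> A}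
    \<le> real (card ?I) * (1 / 2) ^ (a * a)"
  proof (rule prob_union_bound[where F = "\<lambda>(X, Y). {A. X \<times> Y \<subseteq> A}"])
    fix XY assume "XY \<in> ?I"
    then obtain X Y where XY: "XY = (X, Y)" "X \<subseteq> S" "card X = a" "Y \<subseteq> T" "card Y = a" by auto
    then have "finite (X \<times> Y)" "X \<times> Y \<subseteq> kp_arcs k n"
      using assms(1-3) by (auto dest: finite_subset)
    moreover have "X \<times> Y \<inter> (X \<times> Y)\<inverse> = {}" using XY assms(4) by blast
    ultimately have "kp_prob k n {A. X \<times> Y \<subseteq> A} = (1 / 2) ^ card (X \<times> Y)"
      by (intro prob_arcs_subset)
    then show "kp_prob k n (case XY of (X, Y) \<Rightarrow> {A. X \<times> Y \<subseteq> A}) \<le> (1 / 2) ^ (a * a)"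
      using XY by (simp add: card_cartesian_product)
  qed (use assms(1,2) in auto)
  also have "card ?I \<le> card S ^ a * card T ^ a"
    unfolding card_cartesian_product using assms(1,2) by (intro mult_mono card_subsets_of_size_le) auto
  then have "real (card ?I) \<le> real (card S) ^ a * real (card T) ^ a"
    by (simp flip: of_nat_power of_nat_mult)
  finally show ?thesis by (simp add: mult_right_mono)
qed

definition kp_class :: "nat \<Rightarrow> nat \<Rightarrow> (nat \<times> nat) set" where
  "kp_class m i = {i} \<times> {..<m}"

lemma finite_kp_class: "finite (kp_class m i)"
  and card_kp_class: "card (kp_class m i) = m"
  unfolding kp_class_def by auto

lemma fst_kp_class: "u \<in> kp_class m i \<Longrightarrow> fst u = i"
  unfolding kp_class_def by auto

lemma kp_class_disjoint: "i \<noteq> j \<Longrightarrow> kp_class m i \<inter> kp_class m j = {}"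
  unfolding kp_class_def by auto

lemma kp_class_subset_kp_vertices: "i < k \<Longrightarrow> m \<le> n i \<Longrightarrow> kp_class m i \<subseteq> kp_vertices k n"
  unfolding kp_class_def kp_vertices_def by auto

lemma kp_arcs_between_classes:
  assumes "\<And>i. i < k \<Longrightarrow> m \<le> n i" "i < k" "j < k" "i \<noteq> j" "u \<in> kp_class m i" "v \<in> kp_class m j"
  shows "(u, v) \<in> kp_arcs k n"
  using assms kp_class_subset_kp_vertices[of i k m n] kp_class_subset_kp_vertices[of j k m n]
  by (auto simp: kp_arcs_def dest: fst_kp_class)

definition unidirectional :: "nat \<Rightarrow> nat \<Rightarrow> nat \<Rightarrow> arc_set \<Rightarrow> bool" where
  "unidirectional k m a A \<longleftrightarrow> (\<exists>i<k. \<exists>j<k. i \<noteq> j \<and>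
     (\<exists>X\<subseteq>kp_class m i. \<exists>Y\<subseteq>kp_class m j. card X = a \<and> card Y = a \<and> X \<times> Y \<subseteq> A))"

definition few_midpoints :: "nat \<Rightarrow> nat \<Rightarrow> nat \<Rightarrow> arc_set \<Rightarrow> bool" where
  "few_midpoints k m d A \<longleftrightarrow> (\<exists>j<k. \<exists>u\<in>{..<k} \<times> {..<m}. \<exists>v\<in>{..<k} \<times> {..<m}.
     u \<noteq> v \<and> fst u \<noteq> j \<and> fst v \<noteq> j \<and> card (kp_class m j \<inter> midpoints A v u) < d)"

lemma prob_unidirectional_le:
  assumes "\<And>i. i < k \<Longrightarrow> m \<le> n i"
  shows "kp_prob k n {A. unidirectional k m a A}
    \<le> real k ^ 2 * (real m ^ (2 * a) * (1 / 2) ^ (a * a))"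
proof -
  let ?I = "{(i, j) \<in> {..<k} \<times> {..<k}. i \<noteq> j}"
  let ?F = "\<lambda>(i, j). {A. \<exists>X\<subseteq>kp_class m i. \<exists>Y\<subseteq>kp_class m j. card X = a \<and> card Y = a \<and> X \<times> Y \<subseteq> A}"
  have "kp_prob k n {A. unidirectional k m a A}
      \<le> real (card ?I) * (real m ^ (2 * a) * (1 / 2) ^ (a * a))"
  proof (rule prob_union_bound[where F = ?F])
    show "finite ?I" by (rule finite_subset[of _ "{..<k} \<times> {..<k}"]) auto
    show "{A. unidirectional k m a A} \<subseteq> (\<Union>x\<in>?I. ?F x)"
      unfolding unidirectional_def by blast
    fix x assume "x \<in> ?I"
    then obtain i j where ij: "x = (i, j)" "i < k" "j < k" "i \<noteq> j" by auto
    have "kp_class m i \<times> kp_class m j \<subseteq> kp_arcs k n"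
      using assms ij by (auto intro: kp_arcs_between_classes)
    then show "kp_prob k n (?F x) \<le> real m ^ (2 * a) * (1 / 2) ^ (a * a)"
      using prob_all_arcs_between_subsets_le[OF finite_kp_class finite_kp_class, of m i m j k n a]
        kp_class_disjoint[OF ij(4)] ij(1) by (simp add: card_kp_class mult_2 power_add)
  qed
  also have "real (card ?I) \<le> real (card ({..<k} \<times> {..<k}))"
    by (intro of_nat_mono card_mono) auto
  also have "\<dots> = real k ^ 2" by (simp add: power2_eq_square)
  finally show ?thesis by (simp add: mult_right_mono)
qed

lemma prob_few_midpoints_le:
  assumes "\<And>i. i < k \<Longrightarrow> m \<le> n i" "d \<le> m"
  shows "kp_prob k n {A. few_midpoints k m d A} \<le> real k ^ 3 * (real m ^ (d + 2) * (3 / 4) ^ (m - d))"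
proof -
  let ?V = "{..<k} \<times> {..<m}"
  let ?I = "{(j, u, v) \<in> {..<k} \<times> ?V \<times> ?V. u \<noteq> v \<and> fst u \<noteq> j \<and> fst v \<noteq> j}"
  let ?F = "\<lambda>(j, u, v). {A :: arc_set. card (kp_class m j \<inter> midpoints A v u) < d}"
  have "kp_prob k n {A. few_midpoints k m d A}
      \<le> real (card ?I) * (real m ^ d * (3 / 4) ^ (m - d))"
  proof (rule prob_union_bound[where F = ?F])
    show "finite ?I" by (rule finite_subset[of _ "{..<k} \<times> ?V \<times> ?V"]) auto
    show "{A. few_midpoints k m d A} \<subseteq> (\<Union>x\<in>?I. ?F x)"
      unfolding few_midpoints_def by blast
    fix x assume "x \<in> ?I"
    then obtain j u v where x: "x = (j, u, v)" "j < k" "u \<in> ?V" "v \<in> ?V" "u \<noteq> v"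
      "fst u \<noteq> j" "fst v \<noteq> j" by blast
    have "(v, w) \<in> kp_arcs k n \<and> (w, u) \<in> kp_arcs k n" if "w \<in> kp_class m j" for w
      using x that assms(1) kp_arcs_between_classes[of k m n "fst v" j v w]
        kp_arcs_between_classes[of k m n j "fst u" w u] by (auto simp: kp_class_def)
    then show "kp_prob k n (?F x) \<le> real m ^ d * (3 / 4) ^ (m - d)"
      using prob_card_midpoints_less_le[OF finite_kp_class x(5), of m j k n d] assms(2) x(1)
      by (simp add: card_kp_class)
  qed
  also have "\<dots> \<le> (real k ^ 3 * real m ^ 2) * (real m ^ d * (3 / 4) ^ (m - d))"
  proof (rule mult_right_mono)
    have "card ?I \<le> card ({..<k} \<times> ?V \<times> ?V)" by (intro card_mono) auto
    also have "\<dots> = k ^ 3 * m ^ 2" by (simp add: power2_eq_square power3_eq_cube)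
    finally have "real (card ?I) \<le> real (k ^ 3 * m ^ 2)" by (rule of_nat_mono)
    then show "real (card ?I) \<le> real k ^ 3 * real m ^ 2" by simp
  qed simp
  finally show ?thesis by (simp only: power_add ac_simps)
qed

section \<open>Feedback arc sets and linear orders\<close>

lemma ex_dir_cycle:
  assumes "\<not> acyclic R" "\<And>x. (x, x) \<notin> R"
  obtains cs where "dir_cycle R cs"
proof -
  obtain x y where xy: "(x, y) \<in> R" "(y, x) \<in> R\<^sup>*"
    using assms(1) unfolding acyclic_def by (meson tranclD)
  let ?r = "\<lambda>u v. (u, v) \<in> R"
  have "?r\<^sup>*\<^sup>* y x" using xy(2) by (simp add: rtranclp_rtrancl_eq)
  then obtain xs' where "rtrancl_path ?r y xs' x" by (auto simp: rtranclp_eq_rtrancl_path)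
  then obtain xs where xs: "rtrancl_path ?r y xs x" "distinct (y # xs)"
    by (rule rtrancl_path_distinct)
  have "xs \<noteq> []" using xs(1) xy(1) assms(2) by (auto elim: rtrancl_path.cases)
  have "((y # xs) ! i, (y # xs) ! ((i + 1) mod length (y # xs))) \<in> R" if "i < length (y # xs)" for i
  proof (cases "i < length xs")
    case True
    then show ?thesis using rtrancl_path_nth[OF xs(1), of i] by simp
  next
    case False
    then have "i = length xs" using that by simp
    then show ?thesis
      using xy(1) rtrancl_path_last[OF xs(1) \<open>xs \<noteq> []\<close>] \<open>xs \<noteq> []\<close> by (simp add: last_conv_nth)
  qed
  then have "dir_cycle R (y # xs)"
    unfolding dir_cycle_def using xs(2) \<open>xs \<noteq> []\<close> by (auto simp: Suc_le_eq)
  then show thesis by (rule that)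
qed

lemma acyclic_Diff_feedback_arc_set:
  assumes "feedback_arc_set A F" "\<And>x. (x, x) \<notin> A"
  shows "acyclic (A - F)"
proof (rule ccontr)
  assume "\<not> acyclic (A - F)"
  then obtain cs where "dir_cycle (A - F) cs" using ex_dir_cycle assms(2) by (metis DiffD1)
  then show False using assms(1) unfolding feedback_arc_set_def dir_cycle_def by blast
qed

lemma ex_inj_rank:
  fixes V :: "'v set"
  assumes "finite V" "wf R"
  obtains ord :: "'v \<Rightarrow> nat"
    where "inj_on ord V" "\<And>u v. u \<in> V \<Longrightarrow> v \<in> V \<Longrightarrow> (u, v) \<in> R \<Longrightarrow> ord u < ord v"
proof -
  have "\<exists>ord :: 'v \<Rightarrow> nat. inj_on ord V \<and> (\<forall>u\<in>V. \<forall>v\<in>V. (u, v) \<in> R \<longrightarrow> ord u < ord v)"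
    using assms(1)
  proof (induction V rule: finite_psubset_induct)
    case (psubset V)
    show ?case
    proof (cases "V = {}")
      case False
      then obtain r where r: "r \<in> V" "\<And>u. (u, r) \<in> R \<Longrightarrow> u \<notin> V"
        using wfE_min[OF assms(2)] by blast
      obtain ord :: "'v \<Rightarrow> nat" where "inj_on ord (V - {r})"
        "\<forall>u\<in>V - {r}. \<forall>v\<in>V - {r}. (u, v) \<in> R \<longrightarrow> ord u < ord v"
        using psubset.IH[of "V - {r}"] r(1) by blast
      then show ?thesis
        using r by (intro exI[of _ "\<lambda>v. if v = r then 0 else Suc (ord v)"]) (auto simp: inj_on_def)
    qed simp
  qed
  then show thesis using that by blast
qed

definition backward_arcs :: "('v \<Rightarrow> nat) \<Rightarrow> ('v \<times> 'v) set \<Rightarrow> ('v \<times> 'v) set" where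
  "backward_arcs ord A = {(u, v) \<in> A. ord v < ord u}"

lemma feedback_arc_set_contains_backward_arcs:
  fixes V :: "'v set"
  assumes "feedback_arc_set A F" "\<And>x. (x, x) \<notin> A" "finite V" "A \<subseteq> V \<times> V"
  obtains ord :: "'v \<Rightarrow> nat" where "inj_on ord V" "backward_arcs ord A \<subseteq> F"
proof -
  have "finite (A - F)" using assms(3,4) finite_subset by blast
  then have "wf (A - F)" using acyclic_Diff_feedback_arc_set[OF assms(1,2)] by (rule finite_acyclic_wf)
  then obtain ord :: "'v \<Rightarrow> nat" where ord: "inj_on ord V"
    "\<And>u v. u \<in> V \<Longrightarrow> v \<in> V \<Longrightarrow> (u, v) \<in> A - F \<Longrightarrow> ord u < ord v"
    using ex_inj_rank[OF assms(3)] by metis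
  have "(u, v) \<in> F" if "(u, v) \<in> A" "ord v < ord u" for u v
    using that ord(2)[of u v] assms(4) by fastforce
  then show thesis using ord(1) by (intro that) (auto simp: backward_arcs_def)
qed

lemma feedback_arc_set_weakly_backward:
  fixes lev :: "'v \<Rightarrow> nat"
  shows "feedback_arc_set A {(u, v) \<in> A. lev v \<le> lev u}"
  unfolding feedback_arc_set_def
proof (intro conjI allI impI)
  fix cs assume cs: "dir_cycle A cs"
  then have "cs \<noteq> []" unfolding dir_cycle_def by auto
  then have "Max (lev ` set cs) \<in> lev ` set cs" by (intro Max_in) auto
  then obtain i where i: "i < length cs" "lev (cs ! i) = Max (lev ` set cs)"
    by (auto simp: in_set_conv_nth)
  have "cs ! ((i + 1) mod length cs) \<in> set cs" using \<open>cs \<noteq> []\<close> by simp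
  then have "lev (cs ! ((i + 1) mod length cs)) \<le> lev (cs ! i)" unfolding i(2) by simp
  then show "\<exists>i<length cs. (cs ! i, cs ! ((i + 1) mod length cs)) \<in> {(u, v) \<in> A. lev v \<le> lev u}"
    using cs i(1) unfolding dir_cycle_def by blast
qed auto

lemma separated_subsets_at_threshold:
  fixes ord :: "'v \<Rightarrow> nat"
  assumes "inj_on ord (X \<union> Y)" "X \<inter> Y = {}" "card Y \<ge> 2 * a"
    and le: "a \<le> card {x \<in> X. ord x \<le> t}" and less: "card {y \<in> Y. ord y < t} < a"
  obtains X' Y' where "X' \<subseteq> X" "Y' \<subseteq> Y" "card X' = a" "card Y' = a"
    "\<And>x y. x \<in> X' \<Longrightarrow> y \<in> Y' \<Longrightarrow> ord x < ord y"
proof -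
  obtain X' where X': "X' \<subseteq> {x \<in> X. ord x \<le> t}" "card X' = a"
    using obtain_subset_with_card_n[OF le] by blast
  have "finite Y" using assms(3) less by (intro card_ge_0_finite) linarith
  then have "card Y - card {y \<in> Y. ord y < t} \<le> card (Y - {y \<in> Y. ord y < t})"
    by (intro diff_card_le_card_Diff) simp
  then have "a \<le> card (Y - {y \<in> Y. ord y < t})" using assms(3) less by linarith
  then obtain Y' where Y': "Y' \<subseteq> Y - {y \<in> Y. ord y < t}" "card Y' = a"
    using obtain_subset_with_card_n by blast
  have "ord x < ord y" if "x \<in> X'" "y \<in> Y'" for x y
  proof -
    have "x \<in> X" "ord x \<le> t" "y \<in> Y" "t \<le> ord y" using that X'(1) Y'(1) by fastforce+
    moreover from this have "ord x \<noteq> ord y" using assms(1,2) by (auto simp: inj_on_def)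
    ultimately show ?thesis by linarith
  qed
  then show thesis using X' Y' by (intro that[of X' Y']) auto
qed

lemma separated_subsets:
  fixes ord :: "'v \<Rightarrow> nat"
  assumes "inj_on ord (X \<union> Y)" "X \<inter> Y = {}" "card X \<ge> 2 * a" "card Y \<ge> 2 * a" "a > 0"
  obtains X' Y' where "X' \<subseteq> X" "Y' \<subseteq> Y" "card X' = a" "card Y' = a"
    "(\<forall>x\<in>X'. \<forall>y\<in>Y'. ord x < ord y) \<or> (\<forall>x\<in>X'. \<forall>y\<in>Y'. ord y < ord x)"
proof -
  let ?le = "\<lambda>S t. {x \<in> S. ord x \<le> t}" and ?less = "\<lambda>S t. {x \<in> S. ord x < t}"
  have "finite X" using assms(3,5) by (intro card_ge_0_finite) linarith
  then have "?le X (Max (ord ` X)) = X" by auto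
  then have "a \<le> card (?le X (Max (ord ` X)))" using assms(3) by simp
  then obtain t where t: "a \<le> card (?le X t) \<or> a \<le> card (?le Y t)"
    and least: "\<And>t'. t' < t \<Longrightarrow> \<not> (a \<le> card (?le X t') \<or> a \<le> card (?le Y t'))"
    using exists_least_iff[of "\<lambda>t. a \<le> card (?le X t) \<or> a \<le> card (?le Y t)"] by blast
  have "?less S t = (if t = 0 then {} else ?le S (t - 1))" for S by auto
  then have less: "card (?less X t) < a" "card (?less Y t) < a"
    using least[of "t - 1"] assms(5) by (auto simp: not_le)
  from t show thesis
  proof
    assume X: "a \<le> card (?le X t)"
    obtain X' Y' where "X' \<subseteq> X" "Y' \<subseteq> Y" "card X' = a" "card Y' = a"
      "\<And>x y. x \<in> X' \<Longrightarrow> y \<in> Y' \<Longrightarrow> ord x < ord y"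
      by (rule separated_subsets_at_threshold[OF assms(1,2,4) X less(2)]) blast
    then show thesis by (intro that[of X' Y']) auto
  next
    assume Y: "a \<le> card (?le Y t)"
    have disjoint: "inj_on ord (Y \<union> X)" "Y \<inter> X = {}" using assms(1,2) by (auto simp: Un_commute)
    obtain Y' X' where "Y' \<subseteq> Y" "X' \<subseteq> X" "card Y' = a" "card X' = a"
      "\<And>y x. y \<in> Y' \<Longrightarrow> x \<in> X' \<Longrightarrow> ord y < ord x"
      by (rule separated_subsets_at_threshold[OF disjoint assms(3) Y less(1)]) blast
    then show thesis by (intro that[of X' Y']) auto
  qed
qed

section \<open>Disjoint transitive cliques\<close>

definition transitive_clique :: "nat \<Rightarrow> ('v \<times> 'v) set \<Rightarrow> (nat \<Rightarrow> 'v) \<Rightarrow> bool" where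
  "transitive_clique k F f \<longleftrightarrow> (\<forall>j<k. \<forall>j'<k. j < j' \<longrightarrow> (f j, f j') \<in> F)"

lemma has_disjoint_TTs_iff:
  "has_disjoint_TTs k F t \<longleftrightarrow>
    (\<exists>c. inj_on (\<lambda>(a, j). c a j) ({..<t} \<times> {..<k}) \<and> (\<forall>a<t. transitive_clique k F (c a)))"
  unfolding has_disjoint_TTs_def transitive_clique_def ..

lemma transitive_clique_mono: "transitive_clique k F f \<Longrightarrow> F \<subseteq> F' \<Longrightarrow> transitive_clique k F' f"
  unfolding transitive_clique_def by blast

lemma transitive_clique_adjacent:
  assumes "transitive_clique k F f" "j < k" "j' < k" "j \<noteq> j'"
  shows "(f j, f j') \<in> F \<or> (f j', f j) \<in> F"
  using assms unfolding transitive_clique_def by (metis linorder_neqE_nat)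

lemma has_disjoint_TTs_le_card_hitting_set:
  assumes "has_disjoint_TTs k F t" "finite S"
    and hit: "\<And>f. transitive_clique k F f \<Longrightarrow> \<exists>j<k. f j \<in> S"
  shows "t \<le> card S"
proof -
  obtain c where inj: "inj_on (\<lambda>(a, j). c a j) ({..<t} \<times> {..<k})"
    and clique: "\<And>a. a < t \<Longrightarrow> transitive_clique k F (c a)"
    using assms(1) unfolding has_disjoint_TTs_iff by blast
  have "\<exists>j<k. c a j \<in> S" if "a < t" for a by (rule hit[OF clique[OF that]])
  then obtain q where q: "\<And>a. a < t \<Longrightarrow> q a < k \<and> c a (q a) \<in> S" by metis
  have "inj_on (\<lambda>a. c a (q a)) {..<t}"
  proof (rule inj_onI)
    fix a b assume "a \<in> {..<t}" "b \<in> {..<t}" "c a (q a) = c b (q b)"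
    then show "a = b" using inj_onD[OF inj, of "(a, q a)" "(b, q b)"] q by auto
  qed
  moreover have "(\<lambda>a. c a (q a)) ` {..<t} \<subseteq> S" using q by auto
  ultimately have "card {..<t} \<le> card S" using assms(2) by (rule card_inj_on_le)
  then show ?thesis by simp
qed

lemma has_disjoint_TTs_card:
  assumes "finite P" "disjoint P"
    and "\<And>K. K \<in> P \<Longrightarrow> \<exists>f. bij_betw f {..<k} K \<and> transitive_clique k F f"
  shows "has_disjoint_TTs k F (card P)"
proof -
  obtain f where bij: "\<And>K. K \<in> P \<Longrightarrow> bij_betw (f K) {..<k} K"
    and clique: "\<And>K. K \<in> P \<Longrightarrow> transitive_clique k F (f K)"
    using assms(3) by metis
  obtain h where h: "bij_betw h {..<card P} P"
    using ex_bij_betw_nat_finite[OF assms(1)] by (metis atLeast0LessThan)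
  then have hP: "h b \<in> P" if "b < card P" for b using that by (auto simp: bij_betw_def)
  have "inj_on (\<lambda>(b, j). f (h b) j) ({..<card P} \<times> {..<k})"
  proof (rule inj_onI, clarsimp)
    fix b j b' j'
    assume b: "b < card P" "j < k" "b' < card P" "j' < k" and eq: "f (h b) j = f (h b') j'"
    have "f (h b) j \<in> h b" "f (h b') j' \<in> h b'"
      using bij_betwE[OF bij[OF hP[OF b(1)]]] bij_betwE[OF bij[OF hP[OF b(3)]]] b(2,4) by auto
    then have "h b = h b'" using eq assms(2) hP b(1,3) unfolding disjoint_def by auto
    then show "b = b' \<and> j = j'"
      using h bij[OF hP[OF b(1)]] b eq by (auto simp: bij_betw_def inj_on_def)
  qed
  then show ?thesis
    unfolding has_disjoint_TTs_iff using clique hP by (intro exI[of _ "\<lambda>b. f (h b)"]) simp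
qed

lemma transitive_clique_of_decreasing_order:
  fixes ord :: "'v \<Rightarrow> nat"
  assumes "finite K" "inj_on ord K" "\<And>x y. x \<in> K \<Longrightarrow> y \<in> K \<Longrightarrow> ord y < ord x \<Longrightarrow> (x, y) \<in> F"
  shows "\<exists>f. bij_betw f {..<card K} K \<and> transitive_clique (card K) F f"
proof -
  have card: "card (ord ` K) = card K" using assms(2) by (rule card_image)
  obtain h where h: "bij_betw h {..<card K} (ord ` K)" "strict_mono_on {..<card K} h"
    using ex_bij_betw_strict_mono_card[of "ord ` K"] assms(1) card by auto
  define f where "f = inv_into K ord \<circ> h \<circ> (\<lambda>j. card K - Suc j)"
  have reverse: "bij_betw (\<lambda>j. card K - Suc j) {..<card K} {..<card K}"
    by (rule bij_betw_byWitness[where f' = "\<lambda>j. card K - Suc j"]) auto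
  have "bij_betw (inv_into K ord) (ord ` K) K"
    by (rule bij_betw_inv_into[OF inj_on_imp_bij_betw[OF assms(2)]])
  then have bij: "bij_betw f {..<card K} K"
    unfolding f_def by (rule bij_betw_trans[OF reverse bij_betw_trans[OF h(1)]])
  have "ord (f j') < ord (f j)" if "j < j'" "j' < card K" for j j'
  proof -
    have "ord (f i) = h (card K - Suc i)" if "i < card K" for i
      using that bij_betwE[OF h(1)] unfolding f_def by (simp add: f_inv_into_f)
    then show ?thesis using that h(2) by (auto simp: strict_mono_on_def)
  qed
  moreover have "f j \<in> K" if "j < card K" for j using bij that by (auto simp: bij_betw_def)
  ultimately have "transitive_clique (card K) F f"
    unfolding transitive_clique_def using assms(3) by auto
  then show ?thesis using bij by blast
qed

lemma transitive_clique_meets_class: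
  assumes A: "A \<in> kp_tournaments k n" and "k \<ge> 2" "transitive_clique k A f" "i < k"
  obtains j where "j < k" "f j \<in> kp_vertices k n" "fst (f j) = i"
proof -
  have arc: "(f j, f j') \<in> kp_arcs k n" if "j < k" "j' < k" "j \<noteq> j'" for j j'
    using transitive_clique_adjacent[OF assms(3) that] kp_tournament_subset[OF A] kp_arcs_swap by blast
  have vertex: "f j \<in> kp_vertices k n" if "j < k" for j
    using arc[OF that, of "if j = 0 then 1 else 0"] that \<open>k \<ge> 2\<close>
    by (auto simp: kp_arcs_def split: if_splits)
  have "inj_on (fst \<circ> f) {..<k}"
    using arc by (intro inj_onI) (fastforce simp: kp_arcs_def)
  moreover have "(fst \<circ> f) ` {..<k} \<subseteq> {..<k}"
    using vertex by (auto simp: kp_vertices_def case_prod_unfold)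
  ultimately have "(fst \<circ> f) ` {..<k} = {..<k}" by (intro endo_inj_surj) auto
  then have "i \<in> (fst \<circ> f) ` {..<k}" using \<open>i < k\<close> by simp
  then show thesis using that vertex by auto
qed

lemma ex_feedback_arc_set_isolating:
  assumes A: "A \<in> kp_tournaments k n" and b: "\<And>i. fst (b i) = c"
  obtains F where "feedback_arc_set A F"
    "\<And>w. fst w \<noteq> c \<Longrightarrow> (b (fst w), w) \<notin> F \<and> (w, b (fst w)) \<notin> F"
proof -
  define lev :: "nat \<times> nat \<Rightarrow> nat" where
    "lev w = (if fst w = c then 1 else if (b (fst w), w) \<in> A then 2 else 0)" for w
  have "(b (fst w), w) \<notin> {(u, v) \<in> A. lev v \<le> lev u} \<and> (w, b (fst w)) \<notin> {(u, v) \<in> A. lev v \<le> lev u}"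
    if "fst w \<noteq> c" for w
    using that b kp_tournament_asym[OF A, of "b (fst w)" w] unfolding lev_def by auto
  then show thesis using feedback_arc_set_weakly_backward by (rule that[rotated])
qed

lemma disjoint_TTs_le_class_size:
  assumes A: "A \<in> kp_tournaments k n" and "k \<ge> 2" "c < k"
    and "\<And>F. feedback_arc_set A F \<Longrightarrow> has_disjoint_TTs k F t"
  shows "t \<le> n c - (k - 1)"
proof -
  obtain h where h: "bij_betw h ({..<k} - {c}) {..<k - 1}"
    using finite_same_card_bij[of "{..<k} - {c}" "{..<k - 1}"] \<open>c < k\<close> by auto
  obtain F where F: "feedback_arc_set A F"
    "\<And>w. fst w \<noteq> c \<Longrightarrow> ((c, h (fst w)), w) \<notin> F \<and> (w, (c, h (fst w))) \<notin> F"
    by (rule ex_feedback_arc_set_isolating[OF A, of "\<lambda>i. (c, h i)" c]) auto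
  have "t \<le> card ({c} \<times> {k - 1..<n c})"
  proof (rule has_disjoint_TTs_le_card_hitting_set[OF assms(4)[OF F(1)]])
    fix f assume f: "transitive_clique k F f"
    then have fA: "transitive_clique k A f"
      using F(1) by (auto simp: feedback_arc_set_def intro: transitive_clique_mono)
    obtain j where j: "j < k" "f j \<in> kp_vertices k n" "fst (f j) = c"
      using transitive_clique_meets_class[OF A \<open>k \<ge> 2\<close> fA \<open>c < k\<close>] .
    have "k - 1 \<le> snd (f j)"
    proof (rule ccontr)
      assume "\<not> k - 1 \<le> snd (f j)"
      then have "snd (f j) \<in> h ` ({..<k} - {c})" using h by (simp add: bij_betw_def)
      then obtain i where i: "i < k" "i \<noteq> c" "h i = snd (f j)" by (elim imageE) auto
      then obtain j' where j': "j' < k" "fst (f j') = i"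
        using transitive_clique_meets_class[OF A \<open>k \<ge> 2\<close> fA, of i] by metis
      have "f j = (c, h (fst (f j')))" using i j j' by (metis prod.collapse)
      then show False
        using F(2)[of "f j'"] transitive_clique_adjacent[OF f j(1) j'(1)] i j' j(3) by auto
    qed
    then show "\<exists>j<k. f j \<in> {c} \<times> {k - 1..<n c}"
      using j by (intro exI[of _ j]) (auto simp: kp_vertices_def mem_Times_iff case_prod_unfold)
  qed simp
  then show ?thesis by simp
qed

section \<open>Clique factors in multipartite graphs without holes\<close>

definition clique_threshold :: "nat \<Rightarrow> nat \<Rightarrow> nat" where
  "clique_threshold k s = k * s ^ k"

definition absorber_threshold :: "nat \<Rightarrow> nat \<Rightarrow> nat \<Rightarrow> nat" where
  "absorber_threshold k s T = (T + k + 1 + clique_threshold k s) * s"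

definition reservoir_size :: "nat \<Rightarrow> nat \<Rightarrow> nat" where
  "reservoir_size k s = (k + 1) * clique_threshold k s * s"

definition absorbing_set_size :: "nat \<Rightarrow> nat \<Rightarrow> nat" where
  "absorbing_set_size k z = (k + 1) * (k * z) ^ k"

text \<open>The third argument of absorber_threshold bounds how many vertices of a class are already in use:
  here, those of the reservoir and of the set absorbing it. At most k * k * s vertices have few
  neighbours in the reservoir.\<close>

definition factor_threshold :: "nat \<Rightarrow> nat \<Rightarrow> nat" where
  "factor_threshold k s = (let z = reservoir_size k s in
     absorber_threshold k s (z + absorbing_set_size k z) + k * k * s)"

locale holefree_multipartite =
  fixes k s :: nat and U :: "nat \<Rightarrow> 'v set" and B :: "'v \<Rightarrow> 'v \<Rightarrow> bool"
  assumes k_pos: "k \<ge> 1" and s_pos: "s \<ge> 1"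
    and finite_U: "\<And>i. i < k \<Longrightarrow> finite (U i)"
    and disjoint_U: "\<And>i j. i < k \<Longrightarrow> j < k \<Longrightarrow> i \<noteq> j \<Longrightarrow> U i \<inter> U j = {}"
    and B_sym: "\<And>x y. B x y \<Longrightarrow> B y x"
    and no_hole: "\<And>i j X Y. i < k \<Longrightarrow> j < k \<Longrightarrow> i \<noteq> j \<Longrightarrow> X \<subseteq> U i \<Longrightarrow> Y \<subseteq> U j \<Longrightarrow>
      card X = s \<Longrightarrow> card Y = s \<Longrightarrow> \<exists>x\<in>X. \<exists>y\<in>Y. B x y"
begin

abbreviation clique_thr :: nat where
  "clique_thr \<equiv> clique_threshold k s"

definition verts :: "'v set" where
  "verts = (\<Union>i<k. U i)"

definition nbrs :: "'v \<Rightarrow> 'v set \<Rightarrow> 'v set" where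
  "nbrs x Y = {y \<in> Y. B x y}"

definition min_degree_ge :: "nat \<Rightarrow> bool" where
  "min_degree_ge D \<longleftrightarrow> (\<forall>j<k. D \<le> card (U j) \<and> (\<forall>i<k. i \<noteq> j \<longrightarrow> (\<forall>x\<in>U i. D \<le> card (nbrs x (U j)))))"

definition partial_clique :: "nat set \<Rightarrow> (nat \<Rightarrow> 'v) \<Rightarrow> bool" where
  "partial_clique I f \<longleftrightarrow> (\<forall>i\<in>I. f i \<in> U i) \<and> pairwise (\<lambda>i j. B (f i) (f j)) I"

definition transversal_clique :: "'v set \<Rightarrow> bool" where
  "transversal_clique K \<longleftrightarrow> (\<exists>f. partial_clique {..<k} f \<and> K = f ` {..<k})"

definition factorable :: "'v set \<Rightarrow> bool" where
  "factorable S \<longleftrightarrow> (\<exists>P. partition_on S P \<and> (\<forall>K\<in>P. transversal_clique K))"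

definition balanced :: "nat \<Rightarrow> 'v set \<Rightarrow> bool" where
  "balanced t S \<longleftrightarrow> S \<subseteq> verts \<and> (\<forall>i<k. card (S \<inter> U i) = t)"

subsection \<open>Balanced sets and clique factors\<close>

lemma finite_verts: "finite verts"
  unfolding verts_def using finite_U by auto

lemma verts_Int_U: "i < k \<Longrightarrow> verts \<inter> U i = U i"
  unfolding verts_def by auto

lemma nbrs_Diff: "nbrs x (Y \<inter> Z) - S = nbrs x ((Y - S) \<inter> Z)"
  unfolding nbrs_def by auto

lemma class_unique: "x \<in> U i \<Longrightarrow> x \<in> U j \<Longrightarrow> i < k \<Longrightarrow> j < k \<Longrightarrow> i = j"
  using disjoint_U by blast

lemma image_Int_class:
  assumes "\<And>i. i < k \<Longrightarrow> f i \<in> U i" "i < k"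
  shows "f ` {..<k} \<inter> U i = {f i}"
  using assms class_unique by auto

lemma card_Un_Int_class_le: "card ((S \<union> T) \<inter> U i) \<le> card (S \<inter> U i) + card (T \<inter> U i)"
  by (simp add: Int_Un_distrib2 card_Un_le)

lemma le_card_Diff_of_class:
  assumes "i < k" "X \<subseteq> U i" "a + card (S \<inter> U i) \<le> card X"
  shows "a \<le> card (X - S)"
proof -
  have "card X - card (S \<inter> U i) \<le> card (X - S \<inter> U i)"
    using finite_U[OF assms(1)] by (intro diff_card_le_card_Diff) auto
  moreover have "X - S \<inter> U i = X - S" using assms(2) by auto
  ultimately show ?thesis using assms(3) by simp
qed

lemma balanced_0_iff: "balanced 0 S \<longleftrightarrow> S = {}"
  unfolding balanced_def verts_def using finite_U by fastforce

lemma finite_balanced: "balanced t S \<Longrightarrow> finite S"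
  unfolding balanced_def using finite_verts finite_subset by blast

lemma card_balanced:
  assumes "balanced t S"
  shows "card S = k * t"
proof -
  have "S = (\<Union>i<k. S \<inter> U i)" using assms unfolding balanced_def verts_def by auto
  also have "card \<dots> = (\<Sum>i<k. card (S \<inter> U i))"
    using finite_U disjoint_U by (intro card_UN_disjoint) auto
  also have "\<dots> = k * t" using assms unfolding balanced_def by simp
  finally show ?thesis .
qed

lemma balanced_Un:
  assumes "balanced a S" "balanced b T" "S \<inter> T = {}"
  shows "balanced (a + b) (S \<union> T)"
proof -
  have "card ((S \<union> T) \<inter> U i) = a + b" if "i < k" for i
  proof -
    have "card (S \<inter> U i \<union> T \<inter> U i) = card (S \<inter> U i) + card (T \<inter> U i)"
      using assms(3) finite_U[OF that] by (intro card_Un_disjoint) auto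
    then show ?thesis using assms(1,2) that by (simp add: balanced_def Int_Un_distrib2)
  qed
  then show ?thesis using assms(1,2) unfolding balanced_def by auto
qed

lemma balanced_Diff:
  assumes "balanced a S" "balanced b T" "T \<subseteq> S"
  shows "balanced (a - b) (S - T)"
proof -
  have "card ((S - T) \<inter> U i) = a - b" if "i < k" for i
  proof -
    have "card (S \<inter> U i - T \<inter> U i) = card (S \<inter> U i) - card (T \<inter> U i)"
      using assms(3) finite_U[OF that] by (intro card_Diff_subset) auto
    moreover have "(S - T) \<inter> U i = S \<inter> U i - T \<inter> U i" by auto
    ultimately show ?thesis using assms(1,2) that by (simp add: balanced_def)
  qed
  then show ?thesis using assms(1) unfolding balanced_def by auto
qed

lemma ex_balanced:
  assumes "\<And>i. i < k \<Longrightarrow> z \<le> card (U i)"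
  shows "\<exists>Z. balanced z Z"
proof -
  have "\<exists>Y\<subseteq>U i. card Y = z" if "i < k" for i
    using assms[OF that] by (metis obtain_subset_with_card_n)
  then obtain Y where Y: "\<And>i. i < k \<Longrightarrow> Y i \<subseteq> U i \<and> card (Y i) = z" by metis
  have "(\<Union>j<k. Y j) \<inter> U i = Y i" if "i < k" for i
    using Y that class_unique by blast
  then have "balanced z (\<Union>j<k. Y j)" unfolding balanced_def verts_def using Y by auto
  then show ?thesis by blast
qed

lemma balanced_image:
  assumes "\<And>i. i < k \<Longrightarrow> r i \<in> U i"
  shows "balanced 1 (r ` {..<k})"
  using assms image_Int_class[of r] unfolding balanced_def verts_def by auto

lemma balanced_1E:
  assumes "balanced 1 R"
  obtains r where "\<And>i. i < k \<Longrightarrow> r i \<in> U i" "R = r ` {..<k}"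
proof -
  have "\<exists>x. R \<inter> U i = {x}" if "i < k" for i
    using assms that unfolding balanced_def by (simp add: card_1_singleton_iff)
  then obtain r where r: "\<And>i. i < k \<Longrightarrow> R \<inter> U i = {r i}" by metis
  moreover have "R = (\<Union>i<k. R \<inter> U i)" using assms unfolding balanced_def verts_def by auto
  ultimately show thesis by (intro that[of r]) auto
qed

lemma balanced_partition_transversals:
  assumes "balanced t S"
  shows "\<exists>P. disjoint P \<and> \<Union>P = S \<and> (\<forall>R\<in>P. balanced 1 R)"
  using assms
proof (induction t arbitrary: S)
  case 0
  then show ?case by (intro exI[of _ "{}"]) (auto simp: balanced_0_iff)
next
  case (Suc t)
  have "\<exists>x. x \<in> S \<inter> U i" if "i < k" for i
    using Suc.prems that unfolding balanced_def by (metis card.empty ex_in_conv nat.distinct(1))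
  then obtain r where r: "\<And>i. i < k \<Longrightarrow> r i \<in> S \<inter> U i" by metis
  let ?R = "r ` {..<k}"
  have R: "balanced 1 ?R" "?R \<subseteq> S" using r balanced_image[of r] by auto
  then have "balanced t (S - ?R)" using balanced_Diff[OF Suc.prems] by fastforce
  from Suc.IH[OF this] obtain P where P: "disjoint P" "\<Union>P = S - ?R" "\<forall>R\<in>P. balanced 1 R"
    by blast
  then have "disjoint (insert ?R P)" by (auto simp: pairwise_insert disjnt_iff)
  then show ?case using P R by (intro exI[of _ "insert ?R P"]) auto
qed

lemma partial_clique_insert:
  assumes "partial_clique I f" "p \<notin> I" "x \<in> U p" "\<And>i. i \<in> I \<Longrightarrow> B x (f i)"
  shows "partial_clique (insert p I) (f(p := x))"
proof -
  have "B (f i) x" if "i \<in> I" for i by (rule B_sym[OF assms(4)[OF that]])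
  then show ?thesis using assms unfolding partial_clique_def by (auto simp: pairwise_def)
qed

lemma transversal_clique_insert:
  assumes "p < k" "x \<in> U p" "partial_clique ({..<k} - {p}) f"
    "\<And>i. i \<in> {..<k} - {p} \<Longrightarrow> B x (f i)"
  shows "transversal_clique (insert x (f ` ({..<k} - {p})))"
proof -
  have "partial_clique (insert p ({..<k} - {p})) (f(p := x))"
    using assms by (intro partial_clique_insert) auto
  moreover have "insert p ({..<k} - {p}) = {..<k}" using assms(1) by auto
  ultimately show ?thesis
    unfolding transversal_clique_def using assms(1) by (intro exI[of _ "f(p := x)"]) auto
qed

lemma transversal_clique_balanced: "transversal_clique K \<Longrightarrow> balanced 1 K"
  unfolding transversal_clique_def partial_clique_def using balanced_image by auto

lemma transversal_clique_pairwise: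
  assumes "transversal_clique K"
  shows "pairwise B K"
proof (rule pairwiseI)
  fix x y assume "x \<in> K" "y \<in> K" "x \<noteq> y"
  moreover obtain f where f: "partial_clique {..<k} f" "K = f ` {..<k}"
    using assms unfolding transversal_clique_def by blast
  ultimately obtain i j where "i < k" "j < k" "i \<noteq> j" "x = f i" "y = f j" by auto
  then show "B x y" using f(1) unfolding partial_clique_def pairwise_def by simp
qed

lemma factorable_empty: "factorable {}"
  unfolding factorable_def by (intro exI[of _ "{}"]) (auto simp: partition_on_empty)

lemma factorable_clique: "transversal_clique K \<Longrightarrow> factorable K"
  using k_pos unfolding factorable_def transversal_clique_def
  by (intro exI[of _ "{K}"] conjI partition_on_space) (auto simp: lessThan_empty_iff)

lemma factorable_Un:
  assumes "factorable S" "factorable T" "S \<inter> T = {}"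
  shows "factorable (S \<union> T)"
proof -
  from assms obtain P Q where "partition_on S P" "partition_on T Q"
    "\<forall>K\<in>P. transversal_clique K" "\<forall>K\<in>Q. transversal_clique K"
    unfolding factorable_def by blast
  then show ?thesis
    using assms(3) unfolding factorable_def
    by (intro exI[of _ "P \<union> Q"]) (auto simp: partition_on_def intro!: disjoint_union)
qed

lemma factorable_UN:
  assumes "finite I" "disjoint_family_on S I" "\<And>i. i \<in> I \<Longrightarrow> factorable (S i)"
  shows "factorable (\<Union>i\<in>I. S i)"
  using assms
proof (induction I rule: finite_induct)
  case empty
  then show ?case by (simp add: factorable_empty)
next
  case (insert i I)
  then have "factorable (\<Union>i\<in>I. S i)" "S i \<inter> (\<Union>i\<in>I. S i) = {}"
    by (auto simp: disjoint_family_on_insert)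
  then show ?case using insert.prems factorable_Un by simp
qed

lemma clique_partition_balanced:
  assumes P: "partition_on S P" "\<And>K. K \<in> P \<Longrightarrow> transversal_clique K"
  shows "balanced (card P) S"
proof -
  have S: "S = \<Union>P" "S \<subseteq> verts"
    using P transversal_clique_balanced unfolding balanced_def partition_on_def by blast+
  then have "finite P" using P(1) finite_verts finite_elements finite_subset by blast
  have "card (S \<inter> U i) = card P" if "i < k" for i
  proof -
    have "S \<inter> U i = (\<Union>K\<in>P. K \<inter> U i)" using S(1) by blast
    also have "card \<dots> = (\<Sum>K\<in>P. card (K \<inter> U i))"
      using \<open>finite P\<close> finite_U[OF that] partition_onD2[OF P(1)]
      by (intro card_UN_disjoint) (auto simp: disjoint_def)
    also have "\<dots> = card P"
      using transversal_clique_balanced[OF P(2)] that by (simp add: balanced_def)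
    finally show ?thesis .
  qed
  then show ?thesis using S(2) unfolding balanced_def by blast
qed

lemma factorable_balanced: "factorable S \<Longrightarrow> \<exists>t. balanced t S"
  unfolding factorable_def using clique_partition_balanced by blast

subsection \<open>Finding cliques\<close>

lemma card_few_nbrs_less:
  assumes "i < k" "j < k" "i \<noteq> j" "Y \<subseteq> U j" "q * s \<le> card Y"
  shows "card {x \<in> U i. card (nbrs x Y) < q} < s"
proof (rule ccontr)
  assume "\<not> ?thesis"
  then have "s \<le> card {x \<in> U i. card (nbrs x Y) < q}" by simp
  then obtain X where X: "X \<subseteq> {x \<in> U i. card (nbrs x Y) < q}" "card X = s" "finite X"
    using obtain_subset_with_card_n by blast
  have "card (\<Union>x\<in>X. nbrs x Y) \<le> (\<Sum>x\<in>X. card (nbrs x Y))" using X(3) by (rule card_UN_le)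
  also have "\<dots> \<le> (\<Sum>x\<in>X. q - 1)" using X(1) by (intro sum_mono) auto
  also have "\<dots> = q * s - s" using X(2) by (cases q) auto
  finally have "card (\<Union>x\<in>X. nbrs x Y) \<le> q * s - s" .
  moreover have "s \<le> q * s" using X(1,2) s_pos by (cases q) auto
  moreover have "finite Y" using assms(2,4) finite_U finite_subset by blast
  then have "card Y - card (\<Union>x\<in>X. nbrs x Y) \<le> card (Y - (\<Union>x\<in>X. nbrs x Y))"
    by (intro diff_card_le_card_Diff) (auto simp: nbrs_def X(3))
  ultimately have "s \<le> card (Y - (\<Union>x\<in>X. nbrs x Y))" using assms(5) by linarith
  then obtain Y' where Y': "Y' \<subseteq> Y - (\<Union>x\<in>X. nbrs x Y)" "card Y' = s"
    using obtain_subset_with_card_n by blast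
  have "\<exists>x\<in>X. \<exists>y\<in>Y'. B x y" using X Y' assms by (intro no_hole[of i j]) auto
  then show False using Y' by (auto simp: nbrs_def)
qed

lemma card_few_nbrs_in_some_class_less:
  assumes "p < k" "J \<subseteq> {..<k} - {p}" "\<And>j. j \<in> J \<Longrightarrow> Y j \<subseteq> U j \<and> q * s \<le> card (Y j)"
  shows "card {x \<in> U p. \<exists>j\<in>J. card (nbrs x (Y j)) < q} < k * s"
proof -
  let ?P = "\<lambda>j. {x \<in> U p. card (nbrs x (Y j)) < q}"
  have "card (?P j) \<le> s" if "j \<in> J" for j
    using that assms(2) assms(3)[OF that]
    by (intro less_imp_le[OF card_few_nbrs_less[OF assms(1), of j]]) auto
  moreover have "finite J" using assms(2) finite_subset by blast
  ultimately have "card (\<Union>j\<in>J. ?P j) \<le> card J * s"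
    using card_UN_le[of J ?P] sum_bounded_above[of J "\<lambda>j. card (?P j)" s] by simp
  also have "card J < k" using card_mono[OF _ assms(2)] assms(1) by simp
  then have "card J * s < k * s" using s_pos by simp
  also have "(\<Union>j\<in>J. ?P j) = {x \<in> U p. \<exists>j\<in>J. card (nbrs x (Y j)) < q}" by auto
  finally show ?thesis .
qed

lemma ex_partial_clique:
  assumes "finite I" "I \<subseteq> {..<k}" "\<And>i. i \<in> I \<Longrightarrow> X i \<subseteq> U i"
    "\<And>i. i \<in> I \<Longrightarrow> k * s ^ card I \<le> card (X i)"
  shows "\<exists>f. partial_clique I f \<and> (\<forall>i\<in>I. f i \<in> X i)"
  using assms
proof (induction I arbitrary: X rule: finite_induct)
  case empty
  then show ?case by (simp add: partial_clique_def)
next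
  case (insert p I)
  define q where "q = k * s ^ card I"
  have p: "p < k" and I: "I \<subseteq> {..<k}" using insert.prems(1) by auto
  have large: "q * s \<le> card (X i)" if "i \<in> insert p I" for i
    using insert.prems(3)[OF that] insert.hyps by (simp add: q_def ac_simps)
  let ?poor = "{x \<in> U p. \<exists>j\<in>I. card (nbrs x (X j)) < q}"
  have "card ?poor < k * s"
    using p I insert.hyps(2) insert.prems(2) large by (intro card_few_nbrs_in_some_class_less) auto
  also have "\<dots> \<le> q * s" using s_pos by (simp add: q_def)
  also have "\<dots> \<le> card (X p)" using large by simp
  finally have "\<not> X p \<subseteq> ?poor"
    using card_mono[of ?poor "X p"] finite_U[OF p] by auto
  then obtain x where x: "x \<in> X p" "x \<notin> ?poor" by blast
  have xU: "x \<in> U p" using x(1) insert.prems(2) by blast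
  have "\<exists>f. partial_clique I f \<and> (\<forall>i\<in>I. f i \<in> nbrs x (X i))"
  proof (rule insert.IH[OF I])
    show "nbrs x (X i) \<subseteq> U i" if "i \<in> I" for i
      using that insert.prems(2)[of i] by (auto simp: nbrs_def)
    show "k * s ^ card I \<le> card (nbrs x (X i))" if "i \<in> I" for i
      using x(2) xU that unfolding q_def by (simp add: not_less)
  qed
  then obtain f where f: "partial_clique I f" "\<And>i. i \<in> I \<Longrightarrow> f i \<in> nbrs x (X i)" by blast
  then have "partial_clique (insert p I) (f(p := x))"
    using insert.hyps(2) xU by (intro partial_clique_insert) (auto simp: nbrs_def)
  moreover have "\<forall>i\<in>insert p I. (f(p := x)) i \<in> X i" using f(2) x(1) by (auto simp: nbrs_def)
  ultimately show ?case by blast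
qed

lemma ex_partial_clique_threshold:
  assumes "I \<subseteq> {..<k}" "\<And>i. i \<in> I \<Longrightarrow> X i \<subseteq> U i" "\<And>i. i \<in> I \<Longrightarrow> clique_thr \<le> card (X i)"
  obtains f where "partial_clique I f" "\<And>i. i \<in> I \<Longrightarrow> f i \<in> X i"
proof -
  have "card I \<le> k" using card_mono[OF _ assms(1)] by simp
  then have "k * s ^ card I \<le> clique_thr"
    unfolding clique_threshold_def using s_pos by (intro mult_left_mono power_increasing) auto
  moreover have "finite I" using assms(1) finite_subset by blast
  ultimately show thesis using assms ex_partial_clique[of I X] that by (meson order_trans)
qed

lemma ex_clique_through_vertex:
  assumes "p < k" "x \<in> U p" "\<And>i. i < k \<Longrightarrow> i \<noteq> p \<Longrightarrow> clique_thr \<le> card (nbrs x (Y \<inter> U i))"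
  obtains K where "transversal_clique K" "x \<in> K" "K \<subseteq> insert x Y"
proof -
  obtain f where f: "partial_clique ({..<k} - {p}) f"
    "\<And>i. i \<in> {..<k} - {p} \<Longrightarrow> f i \<in> nbrs x (Y \<inter> U i)"
    by (rule ex_partial_clique_threshold[of "{..<k} - {p}" "\<lambda>i. nbrs x (Y \<inter> U i)"])
      (use assms(3) in \<open>auto simp: nbrs_def\<close>)
  then have "transversal_clique (insert x (f ` ({..<k} - {p})))"
    using assms by (intro transversal_clique_insert) (auto simp: nbrs_def)
  then show thesis using f(2) by (intro that) (auto simp: nbrs_def)
qed

lemma ex_factorable_cover:
  assumes "finite E" "E \<subseteq> verts"
    "\<And>e i j. e \<in> E \<Longrightarrow> e \<in> U i \<Longrightarrow> i < k \<Longrightarrow> j < k \<Longrightarrow> i \<noteq> j \<Longrightarrow> clique_thr + card E \<le> card (nbrs e (Y \<inter> U j))"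
  shows "\<exists>S. factorable S \<and> E \<subseteq> S \<and> S \<subseteq> E \<union> Y \<and> (\<exists>t\<le>card E. balanced t S)"
  using assms
proof (induction E rule: finite_induct)
  case empty
  then show ?case using factorable_empty balanced_0_iff by blast
next
  case (insert e E)
  have degree: "clique_thr + Suc (card E) \<le> card (nbrs e' (Y \<inter> U j))"
    if "e' \<in> insert e E" "e' \<in> U i" "i < k" "j < k" "i \<noteq> j" for e' i j
    using insert.prems(2)[OF that] insert.hyps by simp
  obtain S t where S: "factorable S" "E \<subseteq> S" "S \<subseteq> E \<union> Y" "t \<le> card E" "balanced t S"
    using insert.IH insert.prems(1) degree by (metis add_Suc_right Suc_leD insert_iff insert_subset)
  show ?case
  proof (cases "e \<in> S")
    case True
    then show ?thesis using S insert.hyps by (intro exI[of _ S] conjI exI[of _ t]) auto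
  next
    case False
    obtain p where p: "p < k" "e \<in> U p" using insert.prems(1) unfolding verts_def by auto
    have "clique_thr \<le> card (nbrs e ((Y - S) \<inter> U j))" if j: "j < k" "j \<noteq> p" for j
    proof -
      have "clique_thr \<le> card (nbrs e (Y \<inter> U j) - S)"
        using degree[of e p j] p j S(4,5)
        by (intro le_card_Diff_of_class[OF j(1)]) (auto simp: nbrs_def balanced_def)
      then show ?thesis by (simp add: nbrs_Diff)
    qed
    then obtain K where K: "transversal_clique K" "e \<in> K" "K \<subseteq> insert e (Y - S)"
      using p ex_clique_through_vertex[of p e "Y - S"] by metis
    have disjoint: "S \<inter> K = {}" using K False by auto
    have "factorable (S \<union> K)" using factorable_Un[OF S(1) factorable_clique[OF K(1)] disjoint] .
    moreover have "balanced (t + 1) (S \<union> K)"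
      using balanced_Un[OF S(5) transversal_clique_balanced[OF K(1)] disjoint] .
    ultimately show ?thesis
      using S K insert.hyps by (intro exI[of _ "S \<union> K"] conjI exI[of _ "t + 1"]) auto
  qed
qed

lemma ex_greedy_factorable:
  assumes "balanced t Y"
  shows "\<exists>S u. factorable S \<and> S \<subseteq> Y \<and> balanced u (Y - S) \<and> u \<le> clique_thr"
  using assms
proof (induction t arbitrary: Y)
  case 0
  then show ?case using factorable_empty by (intro exI[of _ "{}"] exI[of _ 0]) auto
next
  case (Suc t)
  show ?case
  proof (cases "Suc t \<le> clique_thr")
    case True
    then show ?thesis using factorable_empty Suc.prems by (intro exI[of _ "{}"] exI[of _ "Suc t"]) auto
  next
    case False
    obtain f where f: "partial_clique {..<k} f" "\<And>i. i \<in> {..<k} \<Longrightarrow> f i \<in> Y \<inter> U i"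
      by (rule ex_partial_clique_threshold[of "{..<k}" "\<lambda>i. Y \<inter> U i"])
        (use Suc.prems False in \<open>auto simp: balanced_def\<close>)
    define K where "K = f ` {..<k}"
    have K: "transversal_clique K" "K \<subseteq> Y" unfolding transversal_clique_def K_def using f by auto
    have "balanced t (Y - K)"
      using balanced_Diff[OF Suc.prems transversal_clique_balanced[OF K(1)] K(2)] by simp
    then obtain S u where S: "factorable S" "S \<subseteq> Y - K" "balanced u (Y - K - S)" "u \<le> clique_thr"
      using Suc.IH by blast
    moreover have "Y - K - S = Y - (K \<union> S)" by auto
    moreover have "factorable (K \<union> S)"
      using S factorable_clique[OF K(1)] by (intro factorable_Un) auto
    ultimately show ?thesis using K by (intro exI[of _ "K \<union> S"] exI[of _ u]) auto
  qed
qed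

subsection \<open>Absorption\<close>

lemma absorber_threshold_ge: "clique_thr + T + k * s \<le> absorber_threshold k s T"
proof -
  have "clique_thr + T \<le> (clique_thr + T) * s" using s_pos by simp
  then show ?thesis unfolding absorber_threshold_def by (simp add: algebra_simps)
qed

definition absorbs :: "'v set \<Rightarrow> 'v set \<Rightarrow> bool" where
  "absorbs A R \<longleftrightarrow> factorable A \<and> factorable (A \<union> R)"

lemma ex_common_link:
  assumes "p < k" "x \<in> U p" "y \<in> U p"
    "\<And>j. j < k \<Longrightarrow> j \<noteq> p \<Longrightarrow> clique_thr + card (W \<inter> U j) \<le> card (nbrs y (nbrs x (U j)))"
  obtains L where "transversal_clique (insert x L)" "transversal_clique (insert y L)"
    "L \<inter> W = {}"
proof -
  let ?I = "{..<k} - {p}"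
  let ?X = "\<lambda>j. nbrs y (nbrs x (U j)) - W"
  have "clique_thr \<le> card (?X j)" if "j \<in> ?I" for j
    using that assms(4)[of j] by (intro le_card_Diff_of_class[of j]) (auto simp: nbrs_def)
  then obtain f where f: "partial_clique ?I f" "\<And>i. i \<in> ?I \<Longrightarrow> f i \<in> ?X i"
    by (rule ex_partial_clique_threshold[of ?I ?X, rotated 2]) (auto simp: nbrs_def)
  show thesis
  proof (rule that)
    show "transversal_clique (insert x (f ` ?I))" "transversal_clique (insert y (f ` ?I))"
      using f assms(1-3) by (auto intro!: transversal_clique_insert simp: nbrs_def)
    show "f ` ?I \<inter> W = {}" using f(2) by auto
  qed
qed

lemma factorable_exchange_step:
  assumes "p < k" and v: "\<And>i. i < k \<Longrightarrow> v i \<in> U i \<inter> W" and "S \<inter> W = {}" "L \<inter> (W \<union> S) = {}"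
    and "factorable (S \<union> v ` {..<p})" "transversal_clique (insert (v p) L)"
  shows "factorable ((S \<union> L) \<union> v ` {..<Suc p})"
proof -
  have "v p \<noteq> v i" if "i < p" for i
    using v[OF \<open>p < k\<close>] v[of i] class_unique[of "v p" p i] \<open>p < k\<close> that by auto
  moreover have "v i \<in> W" if "i \<le> p" for i using v[of i] \<open>p < k\<close> that by simp
  ultimately have "(S \<union> v ` {..<p}) \<inter> insert (v p) L = {}"
    using assms(3,4) by (fastforce simp: disjoint_iff)
  then have "factorable ((S \<union> v ` {..<p}) \<union> insert (v p) L)"
    by (rule factorable_Un[OF assms(5) factorable_clique[OF assms(6)]])
  moreover have "(S \<union> v ` {..<p}) \<union> insert (v p) L = (S \<union> L) \<union> v ` {..<Suc p}"
    by (auto simp: lessThan_Suc)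
  ultimately show ?thesis by simp
qed

lemma ex_exchange_set:
  assumes r: "\<And>i. i < k \<Longrightarrow> r i \<in> U i \<inter> W" and w: "\<And>i. i < k \<Longrightarrow> w i \<in> U i \<inter> W"
    and common: "\<And>i j. i < k \<Longrightarrow> j < k \<Longrightarrow> i \<noteq> j \<Longrightarrow>
      clique_thr + k + card (W \<inter> U j) \<le> card (nbrs (w i) (nbrs (r i) (U j)))"
    and "p \<le> k"
  shows "\<exists>S. S \<inter> W = {} \<and> factorable (S \<union> r ` {..<p}) \<and> factorable (S \<union> w ` {..<p}) \<and>
    (\<forall>i<k. card (S \<inter> U i) \<le> p)"
  using \<open>p \<le> k\<close>
proof (induction p)
  case 0
  then show ?case using factorable_empty by (intro exI[of _ "{}"]) auto
next
  case (Suc p)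
  then obtain S where S: "S \<inter> W = {}" "factorable (S \<union> r ` {..<p})"
    "factorable (S \<union> w ` {..<p})" "\<And>i. i < k \<Longrightarrow> card (S \<inter> U i) \<le> p" by auto
  have p: "p < k" using Suc.prems by simp
  have "clique_thr + card ((W \<union> S) \<inter> U j) \<le> card (nbrs (w p) (nbrs (r p) (U j)))"
    if "j < k" "j \<noteq> p" for j
    using card_Un_Int_class_le[of W S j] S(4)[of j] common[of p j] that p by linarith
  then obtain L where L: "transversal_clique (insert (r p) L)" "transversal_clique (insert (w p) L)"
    "L \<inter> (W \<union> S) = {}"
    using ex_common_link[of p "r p" "w p" "W \<union> S"] r[OF p] w[OF p] p by auto
  have "card ((S \<union> L) \<inter> U i) \<le> Suc p" if i: "i < k" for i
  proof -
    have "card (L \<inter> U i) \<le> card (insert (r p) L \<inter> U i)"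
      using finite_U[OF i] by (intro card_mono) auto
    also have "\<dots> = 1" using transversal_clique_balanced[OF L(1)] i unfolding balanced_def by auto
    finally show ?thesis using card_Un_Int_class_le[of S L i] S(4)[OF i] by linarith
  qed
  then show ?case
    using factorable_exchange_step[OF p r S(1) L(3) S(2) L(1)]
      factorable_exchange_step[OF p w S(1) L(3) S(3) L(2)] S(1) L(3)
    by (intro exI[of _ "S \<union> L"] conjI allI impI) auto
qed

lemma ex_partner_clique:
  assumes deg: "min_degree_ge (q * s)"
    and large: "\<And>i. i < k \<Longrightarrow> clique_thr + card (W \<inter> U i) + k * s \<le> card (U i)"
    and r: "\<And>i. i < k \<Longrightarrow> r i \<in> U i"
  obtains w where "partial_clique {..<k} w" "\<And>i. i < k \<Longrightarrow> w i \<notin> W"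
    "\<And>i j. i < k \<Longrightarrow> j < k \<Longrightarrow> i \<noteq> j \<Longrightarrow> q \<le> card (nbrs (w i) (nbrs (r i) (U j)))"
proof -
  define P where "P i = {x \<in> U i. \<exists>j\<in>{..<k} - {i}. card (nbrs x (nbrs (r i) (U j))) < q}" for i
  have "clique_thr \<le> card (U i - (W \<union> P i))" if i: "i < k" for i
  proof (rule le_card_Diff_of_class[OF i])
    have "card (P i) < k * s"
      unfolding P_def using i r deg
      by (intro card_few_nbrs_in_some_class_less) (auto simp: nbrs_def min_degree_ge_def)
    moreover have "P i \<inter> U i = P i" by (auto simp: P_def)
    ultimately show "clique_thr + card ((W \<union> P i) \<inter> U i) \<le> card (U i)"
      using card_Un_Int_class_le[of W "P i" i] large[OF i] by simp
  qed simp
  then obtain w where w: "partial_clique {..<k} w" "\<And>i. i \<in> {..<k} \<Longrightarrow> w i \<in> U i - (W \<union> P i)"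
    by (rule ex_partial_clique_threshold[of "{..<k}" "\<lambda>i. U i - (W \<union> P i)", rotated 2]) auto
  have "q \<le> card (nbrs (w i) (nbrs (r i) (U j)))" if "i < k" "j < k" "i \<noteq> j" for i j
  proof -
    have "w i \<in> U i" "w i \<notin> P i" "j \<in> {..<k} - {i}" using w(2)[of i] that by auto
    then have "\<not> card (nbrs (w i) (nbrs (r i) (U j))) < q" unfolding P_def by blast
    then show ?thesis by simp
  qed
  then show thesis using w by (intro that[of w]) auto
qed

text \<open>The absorber consists of a clique w and a set S that forms clique factors with both w and R:
  enlarged by R, it is covered by the factor of S and R and the clique w.\<close>

lemma ex_absorber:
  assumes deg: "min_degree_ge (absorber_threshold k s T)"
    and W: "\<And>i. i < k \<Longrightarrow> card (W \<inter> U i) \<le> T" and R: "balanced 1 R" "R \<subseteq> W"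
  shows "\<exists>A. absorbs A R \<and> A \<inter> W = {} \<and> (\<forall>i<k. card (A \<inter> U i) \<le> k + 1)"
proof -
  obtain r where r: "\<And>i. i < k \<Longrightarrow> r i \<in> U i" "R = r ` {..<k}" by (rule balanced_1E[OF R(1)]) blast
  have "clique_thr + card (W \<inter> U i) + k * s \<le> card (U i)" if "i < k" for i
  proof -
    have "absorber_threshold k s T \<le> card (U i)" using deg that unfolding min_degree_ge_def by blast
    then show ?thesis using absorber_threshold_ge[of T] W[OF that] by linarith
  qed
  then obtain w where w: "partial_clique {..<k} w" "\<And>i. i < k \<Longrightarrow> w i \<notin> W"
    "\<And>i j. i < k \<Longrightarrow> j < k \<Longrightarrow> i \<noteq> j \<Longrightarrow> T + k + 1 + clique_thr \<le> card (nbrs (w i) (nbrs (r i) (U j)))"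
    using ex_partner_clique[OF deg[unfolded absorber_threshold_def] _ r(1)] by metis
  let ?w = "w ` {..<k}"
  have clique: "transversal_clique ?w" unfolding transversal_clique_def using w(1) by blast
  have card_w: "card (?w \<inter> U i) = 1" if "i < k" for i
    using transversal_clique_balanced[OF clique] that by (auto simp: balanced_def)
  have "\<exists>S. S \<inter> (W \<union> ?w) = {} \<and> factorable (S \<union> r ` {..<k}) \<and> factorable (S \<union> ?w) \<and>
    (\<forall>i<k. card (S \<inter> U i) \<le> k)"
  proof (rule ex_exchange_set)
    show "clique_thr + k + card ((W \<union> ?w) \<inter> U j) \<le> card (nbrs (w i) (nbrs (r i) (U j)))"
      if "i < k" "j < k" "i \<noteq> j" for i j
      using card_Un_Int_class_le[of W ?w j] card_w W w(3)[of i j] that by fastforce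
  qed (use r R(2) w(1) in \<open>auto simp: partial_clique_def\<close>)
  then obtain S where S: "S \<inter> (W \<union> ?w) = {}" "factorable (S \<union> R)" "factorable (S \<union> ?w)"
    "\<And>i. i < k \<Longrightarrow> card (S \<inter> U i) \<le> k" unfolding r(2) by blast
  have "(S \<union> R) \<inter> ?w = {}" using S(1) w(2) R(2) by auto
  then have "factorable ((S \<union> R) \<union> ?w)" by (rule factorable_Un[OF S(2) factorable_clique[OF clique]])
  then have "absorbs (S \<union> ?w) R" unfolding absorbs_def using S(3) by (simp add: Un_ac)
  moreover have "card ((S \<union> ?w) \<inter> U i) \<le> k + 1" if "i < k" for i
    using card_Un_Int_class_le[of S ?w i] S(4) card_w that by fastforce
  moreover have "(S \<union> ?w) \<inter> W = {}" using S(1) w(2) by auto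
  ultimately show ?thesis by blast
qed

lemma ex_disjoint_absorbers:
  assumes "finite Q" "\<And>R. R \<in> Q \<Longrightarrow> balanced 1 R \<and> R \<subseteq> Z"
    and "min_degree_ge (absorber_threshold k s T)"
    and "\<And>i. i < k \<Longrightarrow> card (Z \<inter> U i) + (k + 1) * card Q \<le> T"
  shows "\<exists>\<A>. disjoint_family_on \<A> Q \<and> (\<forall>R\<in>Q. absorbs (\<A> R) R \<and> \<A> R \<inter> Z = {}) \<and>
    (\<forall>i<k. card ((\<Union>R\<in>Q. \<A> R) \<inter> U i) \<le> (k + 1) * card Q)"
  using assms(1,2,4)
proof (induction Q rule: finite_induct)
  case empty
  then show ?case by (simp add: disjoint_family_on_def)
next
  case (insert R Q)
  have "card (Z \<inter> U i) + (k + 1) * card Q \<le> T" if "i < k" for i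
    using insert.prems(2)[OF that] insert.hyps by simp
  then obtain \<A> where \<A>: "disjoint_family_on \<A> Q" "\<forall>R\<in>Q. absorbs (\<A> R) R \<and> \<A> R \<inter> Z = {}"
    "\<And>i. i < k \<Longrightarrow> card ((\<Union>R\<in>Q. \<A> R) \<inter> U i) \<le> (k + 1) * card Q"
    using insert.IH insert.prems(1) by auto
  let ?used = "\<Union>R\<in>Q. \<A> R"
  have "card ((Z \<union> ?used) \<inter> U i) \<le> T" if "i < k" for i
    using card_Un_Int_class_le[of Z ?used i] \<A>(3)[OF that] insert.prems(2)[OF that] insert.hyps
    by simp
  moreover have "balanced 1 R" "R \<subseteq> Z \<union> ?used" using insert.prems(1) by auto
  ultimately obtain A where A: "absorbs A R" "A \<inter> (Z \<union> ?used) = {}"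
    "\<And>i. i < k \<Longrightarrow> card (A \<inter> U i) \<le> k + 1"
    using ex_absorber[OF assms(3)] by blast
  let ?\<A> = "\<A>(R := A)"
  have old: "?\<A> R' = \<A> R'" if "R' \<in> Q" for R' using that insert.hyps by auto
  have used: "(\<Union>R\<in>insert R Q. ?\<A> R) = A \<union> ?used"
    by (simp only: UN_insert fun_upd_same old cong: SUP_cong)
  have "disjoint_family_on ?\<A> (insert R Q)"
    using \<A>(1) A(2) old insert.hyps unfolding disjoint_family_on_def by fastforce
  moreover have "\<forall>R'\<in>insert R Q. absorbs (?\<A> R') R' \<and> ?\<A> R' \<inter> Z = {}"
    using \<A>(2) A(1,2) old by auto
  moreover have "card ((A \<union> ?used) \<inter> U i) \<le> (k + 1) * card (insert R Q)" if "i < k" for i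
    using card_Un_Int_class_le[of A ?used i] \<A>(3)[OF that] A(3)[OF that] insert.hyps by simp
  ultimately show ?case unfolding used[symmetric] by blast
qed

definition absorbing :: "'v set \<Rightarrow> 'v set \<Rightarrow> bool" where
  "absorbing A Z \<longleftrightarrow> A \<inter> Z = {} \<and> (\<forall>t. \<forall>Z'\<subseteq>Z. balanced t Z' \<longrightarrow> factorable (A \<union> Z'))"

lemma absorbing_factorable: "absorbing A Z \<Longrightarrow> factorable A"
  unfolding absorbing_def using balanced_0_iff by (metis Un_empty_right empty_subsetI)

lemma absorbing_UN:
  assumes "finite Q" "disjoint_family_on \<A> Q" "\<And>R. R \<in> Q \<Longrightarrow> absorbs (\<A> R) R \<and> \<A> R \<inter> Z = {}"
    and Q: "Q = {R. R \<subseteq> Z \<and> balanced 1 R}"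
  shows "absorbing (\<Union>R\<in>Q. \<A> R) Z"
  unfolding absorbing_def
proof (intro conjI allI impI)
  show "(\<Union>R\<in>Q. \<A> R) \<inter> Z = {}" using assms(3) by auto
  fix t Z' assume "Z' \<subseteq> Z" "balanced t Z'"
  then obtain P where P: "disjoint P" "\<Union>P = Z'" "P \<subseteq> Q"
    using balanced_partition_transversals[of t Z'] unfolding Q by blast
  let ?S = "\<lambda>R. if R \<in> P then \<A> R \<union> R else \<A> R"
  have "?S R \<inter> ?S R' = {}" if "R \<in> Q" "R' \<in> Q" "R \<noteq> R'" for R R'
  proof -
    have "\<A> R \<inter> \<A> R' = {}" using assms(2) that by (auto simp: disjoint_family_on_def)
    moreover have "\<A> R \<inter> R' = {}" "\<A> R' \<inter> R = {}" using assms(3) that unfolding Q by blast+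
    moreover have "R \<inter> R' = {}" if "R \<in> P" "R' \<in> P"
      using that P(1) \<open>R \<noteq> R'\<close> by (auto simp: disjoint_def)
    ultimately show ?thesis by auto
  qed
  then have "factorable (\<Union>R\<in>Q. ?S R)"
    using assms(1,3) by (intro factorable_UN) (auto simp: disjoint_family_on_def absorbs_def)
  moreover have "(\<Union>R\<in>Q. ?S R) = (\<Union>R\<in>Q. \<A> R) \<union> Z'" using P(2,3) by (auto split: if_splits)
  ultimately show "factorable ((\<Union>R\<in>Q. \<A> R) \<union> Z')" by simp
qed

lemma ex_absorbing:
  assumes Z: "balanced z Z"
    and deg: "min_degree_ge (absorber_threshold k s (z + absorbing_set_size k z))"
  obtains A where "absorbing A Z" "\<And>i. i < k \<Longrightarrow> card (A \<inter> U i) \<le> absorbing_set_size k z"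
proof -
  define Q where "Q = {R. R \<subseteq> Z \<and> balanced 1 R}"
  have "Q \<subseteq> {R. R \<subseteq> Z \<and> card R = k}" unfolding Q_def using card_balanced by fastforce
  moreover have "finite Z" using finite_balanced[OF Z] .
  ultimately have "finite Q" "card Q \<le> card {R. R \<subseteq> Z \<and> card R = k}"
    by (auto intro: finite_subset card_mono)
  then have Q: "finite Q" "card Q \<le> (k * z) ^ k"
    using card_subsets_of_size_le[OF \<open>finite Z\<close>, of k] card_balanced[OF Z] by auto
  then have size: "(k + 1) * card Q \<le> absorbing_set_size k z"
    unfolding absorbing_set_size_def by (intro mult_left_mono) auto
  have "\<exists>\<A>. disjoint_family_on \<A> Q \<and> (\<forall>R\<in>Q. absorbs (\<A> R) R \<and> \<A> R \<inter> Z = {}) \<and>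
      (\<forall>i<k. card ((\<Union>R\<in>Q. \<A> R) \<inter> U i) \<le> (k + 1) * card Q)"
    using size Z by (intro ex_disjoint_absorbers[OF Q(1) _ deg]) (auto simp: Q_def balanced_def)
  then obtain \<A> where \<A>: "disjoint_family_on \<A> Q" "\<And>R. R \<in> Q \<Longrightarrow> absorbs (\<A> R) R \<and> \<A> R \<inter> Z = {}"
    "\<And>i. i < k \<Longrightarrow> card ((\<Union>R\<in>Q. \<A> R) \<inter> U i) \<le> (k + 1) * card Q" by blast
  show thesis
  proof (rule that)
    show "absorbing (\<Union>R\<in>Q. \<A> R) Z" using absorbing_UN[OF Q(1) \<A>(1,2) Q_def] .
    show "card ((\<Union>R\<in>Q. \<A> R) \<inter> U i) \<le> absorbing_set_size k z" if "i < k" for i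
      using \<A>(3)[OF that] size by (rule order_trans)
  qed
qed

subsection \<open>Perfect clique factors\<close>

definition poor_vertices :: "'v set \<Rightarrow> nat \<Rightarrow> 'v set" where
  "poor_vertices Z q = (\<Union>i<k. {x \<in> U i. \<exists>j\<in>{..<k} - {i}. card (nbrs x (Z \<inter> U j)) < q})"

lemma le_card_nbrs_if_not_poor:
  assumes "x \<notin> poor_vertices Z q" "x \<in> U i" "i < k" "j < k" "i \<noteq> j"
  shows "q \<le> card (nbrs x (Z \<inter> U j))"
proof -
  have "j \<in> {..<k} - {i}" using assms(4,5) by simp
  then have "\<not> card (nbrs x (Z \<inter> U j)) < q"
    using assms(1-3) unfolding poor_vertices_def by blast
  then show ?thesis by simp
qed

lemma card_poor_vertices_le:
  assumes "\<And>j. j < k \<Longrightarrow> q * s \<le> card (Z \<inter> U j)"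
  shows "card (poor_vertices Z q) \<le> k * k * s"
proof -
  let ?P = "\<lambda>i. {x \<in> U i. \<exists>j\<in>{..<k} - {i}. card (nbrs x (Z \<inter> U j)) < q}"
  have "card (?P i) \<le> k * s" if "i \<in> {..<k}" for i
    using card_few_nbrs_in_some_class_less[of i "{..<k} - {i}" "\<lambda>j. Z \<inter> U j" q] that assms
    by (simp add: less_imp_le)
  then have "card (\<Union>i<k. ?P i) \<le> k * (k * s)"
    using card_UN_le[of "{..<k}" ?P] sum_bounded_above[of "{..<k}" "\<lambda>i. card (?P i)" "k * s"] by simp
  then show ?thesis unfolding poor_vertices_def by (simp add: mult.assoc)
qed

lemma ex_factorable_cover_poor:
  assumes deg: "min_degree_ge (clique_thr + k * k * s + T)" and W: "\<And>i. i < k \<Longrightarrow> card (W \<inter> U i) \<le> T"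
    and Z: "\<And>j. j < k \<Longrightarrow> q * s \<le> card (Z \<inter> U j)"
  obtains S where "factorable S" "poor_vertices Z q - W \<subseteq> S" "S \<inter> W = {}"
proof -
  let ?E = "poor_vertices Z q - W"
  have sub: "?E \<subseteq> verts" unfolding poor_vertices_def verts_def by auto
  have E: "finite ?E" "card ?E \<le> k * k * s"
  proof -
    have "finite (poor_vertices Z q)" unfolding poor_vertices_def using finite_U by auto
    then show "finite ?E" "card ?E \<le> k * k * s"
      using card_poor_vertices_le[OF Z] card_mono[of "poor_vertices Z q" ?E] by auto
  qed
  have "\<exists>S. factorable S \<and> ?E \<subseteq> S \<and> S \<subseteq> ?E \<union> (verts - W) \<and> (\<exists>t\<le>card ?E. balanced t S)"
  proof (rule ex_factorable_cover[OF E(1) sub])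
    fix e i j assume "e \<in> ?E" and e: "e \<in> U i" "i < k" "j < k" "i \<noteq> j"
    have "clique_thr + k * k * s + T \<le> card (nbrs e (U j))"
      using deg e unfolding min_degree_ge_def by blast
    then have "clique_thr + card ?E \<le> card (nbrs e (U j) - W)"
      using E(2) W[OF e(3)] by (intro le_card_Diff_of_class[OF e(3)]) (auto simp: nbrs_def)
    moreover have "nbrs e (U j) - W = nbrs e ((verts - W) \<inter> U j)"
      using nbrs_Diff[of e verts "U j" W] verts_Int_U[OF e(3)] by simp
    ultimately show "clique_thr + card ?E \<le> card (nbrs e ((verts - W) \<inter> U j))" by simp
  qed
  then show thesis using that by blast
qed

lemma ex_almost_factor:
  assumes deg: "min_degree_ge (clique_thr + k * k * s + T)" and "balanced M verts"
    and W: "\<And>i. i < k \<Longrightarrow> card (W \<inter> U i) \<le> T" "balanced t W"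
    and Z: "\<And>j. j < k \<Longrightarrow> q * s \<le> card (Z \<inter> U j)"
  obtains S where "factorable S" "S \<inter> W = {}" "poor_vertices Z q - W \<subseteq> S"
    "card (verts - (W \<union> S)) \<le> k * clique_thr"
proof -
  obtain C where C: "factorable C" "poor_vertices Z q - W \<subseteq> C" "C \<inter> W = {}"
    using ex_factorable_cover_poor[OF deg W(1) Z] .
  obtain c where c: "balanced c C" using factorable_balanced[OF C(1)] by blast
  let ?Y = "verts - (W \<union> C)"
  have "balanced (t + c) (W \<union> C)" using W(2) c C(3) by (intro balanced_Un) auto
  moreover from this have "W \<union> C \<subseteq> verts" by (simp add: balanced_def)
  ultimately have "balanced (M - (t + c)) ?Y" using assms(2) by (intro balanced_Diff)
  then obtain S u where S: "factorable S" "S \<subseteq> ?Y" "balanced u (?Y - S)" "u \<le> clique_thr"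
    using ex_greedy_factorable by blast
  show thesis
  proof (rule that)
    show "factorable (C \<union> S)" using C(1) S(1,2) by (intro factorable_Un) auto
    have "verts - (W \<union> (C \<union> S)) = ?Y - S" by auto
    then show "card (verts - (W \<union> (C \<union> S))) \<le> k * clique_thr" using card_balanced[OF S(3)] S(4) by simp
  qed (use C S in auto)
qed

lemma factorable_verts_if_almost_factor:
  assumes A: "absorbing A Z" and "balanced M verts"
    and S: "factorable S" "S \<inter> (A \<union> Z) = {}" "poor_vertices Z ((k + 1) * clique_thr) - (A \<union> Z) \<subseteq> S"
    and rest: "card (verts - (A \<union> Z \<union> S)) \<le> k * clique_thr"
  shows "factorable verts"
proof -
  let ?R = "verts - (A \<union> Z \<union> S)"
  have AZ: "A \<inter> Z = {}" using A unfolding absorbing_def by blast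
  have "\<exists>C. factorable C \<and> ?R \<subseteq> C \<and> C \<subseteq> ?R \<union> Z \<and> (\<exists>t\<le>card ?R. balanced t C)"
  proof (rule ex_factorable_cover)
    fix e i j assume e: "e \<in> ?R" "e \<in> U i" "i < k" "j < k" "i \<noteq> j"
    then have "(k + 1) * clique_thr \<le> card (nbrs e (Z \<inter> U j))"
      using S(3) by (intro le_card_nbrs_if_not_poor[of e _ _ i]) blast+
    then show "clique_thr + card ?R \<le> card (nbrs e (Z \<inter> U j))" using rest by simp
  qed (use finite_verts in auto)
  then obtain C where C: "factorable C" "?R \<subseteq> C" "C \<subseteq> ?R \<union> Z" by blast
  have SC: "S \<inter> C = {}" using C(3) S(2) by auto
  have disjoint: "A \<inter> (S \<union> C) = {}" using C(3) S(2) AZ by auto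
  have "factorable (S \<union> C)" using factorable_Un[OF S(1) C(1) SC] .
  moreover have "factorable A" using absorbing_factorable[OF A] .
  ultimately have "factorable (A \<union> (S \<union> C))" using disjoint by (simp add: factorable_Un)
  then obtain t where t: "balanced t (A \<union> (S \<union> C))" using factorable_balanced by blast
  let ?Z' = "verts - (A \<union> (S \<union> C))"
  have "balanced (M - t) ?Z'" using assms(2) t by (intro balanced_Diff) (auto simp: balanced_def)
  moreover have "?Z' \<subseteq> Z" using C(2) by auto
  ultimately have "factorable (A \<union> ?Z')" using A unfolding absorbing_def by blast
  then have "factorable ((A \<union> ?Z') \<union> (S \<union> C))"
    by (rule factorable_Un[OF _ \<open>factorable (S \<union> C)\<close>]) (use disjoint in auto)
  moreover have "(A \<union> ?Z') \<union> (S \<union> C) = verts" using t unfolding balanced_def by auto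
  ultimately show ?thesis by simp
qed

theorem perfect_clique_factor:
  assumes deg: "min_degree_ge (factor_threshold k s)" and size: "\<And>i. i < k \<Longrightarrow> card (U i) = M"
  shows "factorable verts"
proof -
  define z where "z = reservoir_size k s"
  define T where "T = z + absorbing_set_size k z"
  have threshold: "factor_threshold k s = absorber_threshold k s T + k * k * s"
    by (simp add: factor_threshold_def T_def z_def Let_def)
  have mono: "min_degree_ge D" if "D \<le> factor_threshold k s" for D
    using deg that unfolding min_degree_ge_def by (meson order_trans)
  have T: "clique_thr + T \<le> absorber_threshold k s T" using absorber_threshold_ge[of T] by linarith
  have M: "balanced M verts" unfolding balanced_def using size verts_Int_U by simp
  have "z \<le> factor_threshold k s" using T threshold by (simp add: T_def)
  then have "z \<le> card (U i)" if "i < k" for i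
    using deg that unfolding min_degree_ge_def by (meson order_trans)
  then obtain Z where Z: "balanced z Z" using ex_balanced by blast
  obtain A where A: "absorbing A Z" "\<And>i. i < k \<Longrightarrow> card (A \<inter> U i) \<le> absorbing_set_size k z"
    using ex_absorbing[OF Z] mono threshold T_def by (metis le_add1)
  obtain a where a: "balanced a A" using factorable_balanced[OF absorbing_factorable[OF A(1)]] by blast
  have "A \<inter> Z = {}" using A(1) unfolding absorbing_def by blast
  obtain S where "factorable S" "S \<inter> (A \<union> Z) = {}"
    "poor_vertices Z ((k + 1) * clique_thr) - (A \<union> Z) \<subseteq> S"
    "card (verts - (A \<union> Z \<union> S)) \<le> k * clique_thr"
  proof (rule ex_almost_factor[OF _ M])
    show "min_degree_ge (clique_thr + k * k * s + T)" using T threshold by (intro mono) simp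
    show "balanced (a + z) (A \<union> Z)" using a Z \<open>A \<inter> Z = {}\<close> by (rule balanced_Un)
    show "card ((A \<union> Z) \<inter> U i) \<le> T" if "i < k" for i
      using card_Un_Int_class_le[of A Z i] A(2)[OF that] Z that by (simp add: T_def balanced_def)
    show "(k + 1) * clique_thr * s \<le> card (Z \<inter> U j)" if "j < k" for j
      using Z that by (simp add: balanced_def z_def reservoir_size_def)
  qed
  then show ?thesis
    using A(1) M by (intro factorable_verts_if_almost_factor[of A Z M S])
qed

lemma ex_clique_tiling:
  assumes "min_degree_ge (factor_threshold k s)" "\<And>i. i < k \<Longrightarrow> card (U i) = M"
  obtains P where "finite P" "disjoint P" "card P = M"
    "\<And>K. K \<in> P \<Longrightarrow> K \<subseteq> verts \<and> card K = k \<and> pairwise B K"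
proof -
  obtain P where P: "partition_on verts P" "\<And>K. K \<in> P \<Longrightarrow> transversal_clique K"
    using perfect_clique_factor[OF assms] unfolding factorable_def by blast
  show thesis
  proof (rule that)
    show "finite P" using finite_elements[OF finite_verts P(1)] .
    show "disjoint P" using P(1) by (rule partition_onD2)
    have "card P = card (verts \<inter> U 0)"
      using clique_partition_balanced[OF P] k_pos by (simp add: balanced_def)
    then show "card P = M" using verts_Int_U[of 0] assms(2)[of 0] k_pos by simp
    show "K \<subseteq> verts \<and> card K = k \<and> pairwise B K" if "K \<in> P" for K
      using transversal_clique_balanced[OF P(2)[OF that]] card_balanced[of 1 K]
        transversal_clique_pairwise[OF P(2)[OF that]] unfolding balanced_def by auto
  qed
qed

end

section \<open>The graph of backward edges\<close>

locale ordered_kp_tournament =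
  fixes k :: nat and n :: "nat \<Rightarrow> nat" and A :: arc_set and ord :: "nat \<times> nat \<Rightarrow> nat" and m :: nat
  assumes A: "A \<in> kp_tournaments k n"
    and inj_ord: "inj_on ord (kp_vertices k n)"
    and class_size: "\<And>i. i < k \<Longrightarrow> m \<le> n i"
begin

definition backward_adjacent :: "nat \<times> nat \<Rightarrow> nat \<times> nat \<Rightarrow> bool" where
  "backward_adjacent x y \<longleftrightarrow> (x, y) \<in> backward_arcs ord A \<or> (y, x) \<in> backward_arcs ord A"

lemma backward_adjacent_sym: "backward_adjacent x y \<Longrightarrow> backward_adjacent y x"
  unfolding backward_adjacent_def by blast

lemma class_subset_vertices: "i < k \<Longrightarrow> kp_class m i \<subseteq> kp_vertices k n"
  using kp_class_subset_kp_vertices class_size by simp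

lemma inj_on_ord_classes: "i < k \<Longrightarrow> j < k \<Longrightarrow> inj_on ord (kp_class m i \<union> kp_class m j)"
  using inj_ord class_subset_vertices by (meson Un_least inj_on_subset)

lemma forward_arc:
  assumes "i < k" "j < k" "i \<noteq> j" "x \<in> kp_class m i" "y \<in> kp_class m j"
    "\<not> backward_adjacent x y" "ord x < ord y"
  shows "(x, y) \<in> A"
  using kp_tournament_total[OF A kp_arcs_between_classes[OF class_size assms(1-5)]] assms(6,7)
  unfolding backward_adjacent_def backward_arcs_def by auto

lemma no_backward_hole:
  assumes "\<not> unidirectional k m a A" "a > 0" and ij: "i < k" "j < k" "i \<noteq> j"
    and X: "X \<subseteq> kp_class m i" "card X = 2 * a" and Y: "Y \<subseteq> kp_class m j" "card Y = 2 * a"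
  shows "\<exists>x\<in>X. \<exists>y\<in>Y. backward_adjacent x y"
proof (rule ccontr)
  assume none: "\<not> ?thesis"
  have "inj_on ord (X \<union> Y)"
    using X(1) Y(1) by (intro inj_on_subset[OF inj_on_ord_classes[OF ij(1,2)]]) auto
  moreover have "X \<inter> Y = {}" using X(1) Y(1) kp_class_disjoint[OF ij(3)] by blast
  ultimately obtain X' Y' where XY': "X' \<subseteq> X" "Y' \<subseteq> Y" "card X' = a" "card Y' = a"
    and order: "(\<forall>x\<in>X'. \<forall>y\<in>Y'. ord x < ord y) \<or> (\<forall>x\<in>X'. \<forall>y\<in>Y'. ord y < ord x)"
    using separated_subsets[of ord X Y a] X(2) Y(2) \<open>a > 0\<close> by auto
  have sub: "X' \<subseteq> kp_class m i" "Y' \<subseteq> kp_class m j" using XY' X Y by auto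
  have nonadjacent: "\<not> backward_adjacent x y \<and> \<not> backward_adjacent y x" if "x \<in> X'" "y \<in> Y'" for x y
    using that none XY'(1,2) backward_adjacent_sym by blast
  from order have "X' \<times> Y' \<subseteq> A \<or> Y' \<times> X' \<subseteq> A"
  proof
    assume less: "\<forall>x\<in>X'. \<forall>y\<in>Y'. ord x < ord y"
    have "(x, y) \<in> A" if "x \<in> X'" "y \<in> Y'" for x y
      using that sub nonadjacent less by (intro forward_arc[OF ij]) blast+
    then show ?thesis by auto
  next
    assume less: "\<forall>x\<in>X'. \<forall>y\<in>Y'. ord y < ord x"
    have "(y, x) \<in> A" if "x \<in> X'" "y \<in> Y'" for x y
      using that sub nonadjacent less by (intro forward_arc[OF ij(2,1) ij(3)[symmetric]]) blast+
    then show ?thesis by auto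
  qed
  then show False using assms(1) ij sub XY'(3,4) unfolding unidirectional_def by metis
qed

definition backward_poor :: "nat \<Rightarrow> nat \<Rightarrow> (nat \<times> nat) set" where
  "backward_poor d j =
     {u \<in> {..<k} \<times> {..<m}. fst u \<noteq> j \<and> card {w \<in> kp_class m j. backward_adjacent u w} < d}"

text \<open>If u precedes v, then every directed path of length two from v to u has a backward edge.\<close>

lemma card_backward_poor_le_1:
  assumes "\<not> few_midpoints k m (2 * d) A" "j < k"
  shows "card (backward_poor d j) \<le> 1"
proof -
  have not_less: "\<not> ord u < ord v"
    if u: "u \<in> backward_poor d j" and v: "v \<in> backward_poor d j" for u v
  proof
    assume less: "ord u < ord v"
    let ?N = "\<lambda>u. {w \<in> kp_class m j. backward_adjacent u w}"
    have "kp_class m j \<inter> midpoints A v u \<subseteq> ?N u \<union> ?N v"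
    proof
      fix w assume "w \<in> kp_class m j \<inter> midpoints A v u"
      then show "w \<in> ?N u \<union> ?N v"
        using less
        by (cases "ord u < ord w") (auto simp: midpoints_def backward_adjacent_def backward_arcs_def)
    qed
    then have "card (kp_class m j \<inter> midpoints A v u) \<le> card (?N u \<union> ?N v)"
      using finite_kp_class by (intro card_mono) auto
    also have "\<dots> \<le> card (?N u) + card (?N v)" by (rule card_Un_le)
    also have "\<dots> < 2 * d" using u v unfolding backward_poor_def by auto
    finally have "card (kp_class m j \<inter> midpoints A v u) < 2 * d" .
    moreover have "u \<in> {..<k} \<times> {..<m}" "v \<in> {..<k} \<times> {..<m}" "fst u \<noteq> j" "fst v \<noteq> j" "u \<noteq> v"
      using u v less unfolding backward_poor_def by auto
    ultimately show False using assms unfolding few_midpoints_def by blast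
  qed
  have "u = v" if "u \<in> backward_poor d j" "v \<in> backward_poor d j" for u v
  proof -
    have "{..<k} \<times> {..<m} \<subseteq> kp_vertices k n" using class_size unfolding kp_vertices_def by fastforce
    then have "u \<in> kp_vertices k n" "v \<in> kp_vertices k n"
      using that unfolding backward_poor_def by auto
    moreover have "ord u = ord v" using not_less[OF that] not_less[OF that(2,1)] by simp
    ultimately show ?thesis using inj_ord by (simp add: inj_on_def)
  qed
  moreover have "finite (backward_poor d j)" unfolding backward_poor_def by simp
  ultimately show ?thesis by (simp add: card_le_Suc0_iff_eq)
qed

lemma ex_rich_subclasses:
  assumes "\<not> few_midpoints k m (2 * d) A" "k - 1 \<le> m"
  obtains U where "\<And>i. i < k \<Longrightarrow> U i \<subseteq> kp_class m i" "\<And>i. i < k \<Longrightarrow> card (U i) = m - (k - 1)"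
    "\<And>i j x. i < k \<Longrightarrow> j < k \<Longrightarrow> i \<noteq> j \<Longrightarrow> x \<in> U i \<Longrightarrow> d - (k - 1) \<le> card {y \<in> U j. backward_adjacent x y}"
proof -
  let ?poor = "\<lambda>i. \<Union>j\<in>{..<k} - {i}. backward_poor d j \<inter> kp_class m i"
  have "\<exists>R. ?poor i \<subseteq> R \<and> R \<subseteq> kp_class m i \<and> card R = k - 1" if i: "i < k" for i
  proof (rule exists_subset_between)
    have "card (backward_poor d j \<inter> kp_class m i) \<le> 1" if "j < k" for j
      by (rule order_trans[OF card_mono card_backward_poor_le_1[OF assms(1) that]])
        (auto simp: backward_poor_def)
    then have "card (?poor i) \<le> card ({..<k} - {i}) * 1"
      by (intro order_trans[OF card_UN_le] sum_bounded_above[THEN order_trans]) auto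
    then show "card (?poor i) \<le> k - 1" using i by simp
  qed (use assms(2) in \<open>auto simp: finite_kp_class card_kp_class\<close>)
  then obtain R where R: "\<And>i. i < k \<Longrightarrow> ?poor i \<subseteq> R i" "\<And>i. i < k \<Longrightarrow> R i \<subseteq> kp_class m i"
    "\<And>i. i < k \<Longrightarrow> card (R i) = k - 1" by metis
  have finR: "finite (R i)" if "i < k" for i using R(2)[OF that] finite_kp_class finite_subset by blast
  show thesis
  proof (rule that)
    show "kp_class m i - R i \<subseteq> kp_class m i" for i by blast
    show "card (kp_class m i - R i) = m - (k - 1)" if "i < k" for i
      using R(2,3)[OF that] finR[OF that] by (simp add: card_Diff_subset card_kp_class)
    fix i j x assume ij: "i < k" "j < k" "i \<noteq> j" and x: "x \<in> kp_class m i - R i"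
    have "x \<in> {..<k} \<times> {..<m}" "fst x \<noteq> j" using x ij by (auto simp: kp_class_def)
    moreover have "x \<notin> backward_poor d j" using R(1)[OF ij(1)] x ij by blast
    ultimately have "d \<le> card {y \<in> kp_class m j. backward_adjacent x y}"
      unfolding backward_poor_def by auto
    then have "d - (k - 1) \<le> card ({y \<in> kp_class m j. backward_adjacent x y} - R j)"
      using diff_card_le_card_Diff[OF finR[OF ij(2)]] R(3)[OF ij(2)]
      by (metis (no_types, lifting) diff_le_mono order_trans)
    also have "{y \<in> kp_class m j. backward_adjacent x y} - R j =
        {y \<in> kp_class m j - R j. backward_adjacent x y}" by blast
    finally show "d - (k - 1) \<le> card {y \<in> kp_class m j - R j. backward_adjacent x y}" .
  qed
qed

lemma transitive_clique_of_backward_adjacent: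
  assumes "K \<subseteq> kp_vertices k n" "pairwise backward_adjacent K"
  shows "\<exists>f. bij_betw f {..<card K} K \<and> transitive_clique (card K) (backward_arcs ord A) f"
proof (rule transitive_clique_of_decreasing_order)
  show "finite K" using assms(1) finite_kp_vertices by (rule finite_subset)
  show "inj_on ord K" using inj_ord assms(1) by (rule inj_on_subset)
  fix x y assume "x \<in> K" "y \<in> K" and less: "ord y < ord x"
  then have "backward_adjacent x y" using assms(2) by (auto simp: pairwise_def)
  then show "(x, y) \<in> backward_arcs ord A"
    using less unfolding backward_adjacent_def backward_arcs_def by auto
qed

lemma ex_backward_clique_tiling:
  assumes "k \<ge> 2" "a > 0" "\<not> unidirectional k m a A" "\<not> few_midpoints k m (2 * d) A"
    and d: "factor_threshold k (2 * a) + k \<le> d" "d \<le> m"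
  obtains P where "finite P" "disjoint P" "card P = m - (k - 1)"
    "\<And>K. K \<in> P \<Longrightarrow> K \<subseteq> kp_vertices k n \<and> card K = k \<and> pairwise backward_adjacent K"
proof -
  obtain U where U: "\<And>i. i < k \<Longrightarrow> U i \<subseteq> kp_class m i" "\<And>i. i < k \<Longrightarrow> card (U i) = m - (k - 1)"
    "\<And>i j x. i < k \<Longrightarrow> j < k \<Longrightarrow> i \<noteq> j \<Longrightarrow> x \<in> U i \<Longrightarrow> d - (k - 1) \<le> card {y \<in> U j. backward_adjacent x y}"
    by (rule ex_rich_subclasses[OF assms(4)]) (use d in auto)
  interpret G: holefree_multipartite k "2 * a" U backward_adjacent
  proof
    show "finite (U i)" if "i < k" for i using U(1)[OF that] finite_kp_class finite_subset by blast
    show "U i \<inter> U j = {}" if "i < k" "j < k" "i \<noteq> j" for i j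
      using U(1)[OF that(1)] U(1)[OF that(2)] kp_class_disjoint[OF that(3)] by blast
    show "\<exists>x\<in>X. \<exists>y\<in>Y. backward_adjacent x y"
      if "i < k" "j < k" "i \<noteq> j" "X \<subseteq> U i" "Y \<subseteq> U j" "card X = 2 * a" "card Y = 2 * a" for i j X Y
      using that U(1) by (intro no_backward_hole[OF assms(3,2)]) blast+
    show "backward_adjacent y x" if "backward_adjacent x y" for x y
      using that by (rule backward_adjacent_sym)
  qed (use \<open>k \<ge> 2\<close> \<open>a > 0\<close> in linarith)+
  have "G.min_degree_ge (factor_threshold k (2 * a))"
    unfolding G.min_degree_ge_def G.nbrs_def
  proof (intro allI impI conjI ballI)
    show "factor_threshold k (2 * a) \<le> card (U j)" if "j < k" for j using U(2)[OF that] d by linarith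
    show "factor_threshold k (2 * a) \<le> card {y \<in> U j. backward_adjacent x y}"
      if "j < k" "i < k" "i \<noteq> j" "x \<in> U i" for i j x
      using U(3)[OF that(2,1,3,4)] d(1) by linarith
  qed
  then obtain P where P: "finite P" "disjoint P" "card P = m - (k - 1)"
    "\<And>K. K \<in> P \<Longrightarrow> K \<subseteq> G.verts \<and> card K = k \<and> pairwise backward_adjacent K"
    by (rule G.ex_clique_tiling[OF _ U(2)]) blast+
  moreover have "G.verts \<subseteq> kp_vertices k n"
    using U(1) class_subset_vertices unfolding G.verts_def by blast
  ultimately show thesis by (intro that[of P]) blast+
qed

lemma disjoint_backward_TTs:
  assumes "k \<ge> 2" "a > 0" "\<not> unidirectional k m a A" "\<not> few_midpoints k m (2 * d) A"
    and "factor_threshold k (2 * a) + k \<le> d" "d \<le> m"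
  shows "has_disjoint_TTs k (backward_arcs ord A) (m - (k - 1))"
proof -
  obtain P where P: "finite P" "disjoint P" "card P = m - (k - 1)"
    "\<And>K. K \<in> P \<Longrightarrow> K \<subseteq> kp_vertices k n \<and> card K = k \<and> pairwise backward_adjacent K"
    by (rule ex_backward_clique_tiling[OF assms]) blast
  have "\<exists>f. bij_betw f {..<k} K \<and> transitive_clique k (backward_arcs ord A) f" if "K \<in> P" for K
    using transitive_clique_of_backward_adjacent[of K] P(4)[OF that] by simp
  from has_disjoint_TTs_card[OF P(1,2) this] show ?thesis unfolding P(3) .
qed

end

lemma has_disjoint_TTs_mono: "has_disjoint_TTs k F t \<Longrightarrow> F \<subseteq> F' \<Longrightarrow> has_disjoint_TTs k F' t"
  unfolding has_disjoint_TTs_iff using transitive_clique_mono by blast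

lemma disjoint_TTs_ge_class_size:
  assumes A: "A \<in> kp_tournaments k n" and "\<And>i. i < k \<Longrightarrow> m \<le> n i" and F: "feedback_arc_set A F"
    and "k \<ge> 2" "a > 0" "\<not> unidirectional k m a A" "\<not> few_midpoints k m (2 * d) A"
    and "factor_threshold k (2 * a) + k \<le> d" "d \<le> m"
  shows "has_disjoint_TTs k F (m - (k - 1))"
proof -
  have "A \<subseteq> kp_vertices k n \<times> kp_vertices k n" "\<And>x. (x, x) \<notin> A"
    using kp_tournament_subset[OF A] unfolding kp_arcs_def by auto
  then obtain ord :: "nat \<times> nat \<Rightarrow> nat" where
    ord: "inj_on ord (kp_vertices k n)" "backward_arcs ord A \<subseteq> F"
    using feedback_arc_set_contains_backward_arcs[OF F _ finite_kp_vertices] by metis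
  interpret ordered_kp_tournament k n A ord m
    using A ord(1) assms(2) by unfold_locales
  show ?thesis using has_disjoint_TTs_mono[OF disjoint_backward_TTs[OF assms(4-)] ord(2)] .
qed

definition midpoint_threshold :: "nat \<Rightarrow> nat \<Rightarrow> nat" where
  "midpoint_threshold k a = 2 * (factor_threshold k (2 * a) + k)"

lemma f_TT_eq:
  assumes A: "A \<in> kp_tournaments k n" and "k \<ge> 2" "c < k" and min: "\<And>i. i < k \<Longrightarrow> n c \<le> n i"
    and "a > 0" "\<not> unidirectional k (n c) a A" "\<not> few_midpoints k (n c) (midpoint_threshold k a) A"
    and "midpoint_threshold k a \<le> n c"
  shows "f_TT k A = n c - (k - 1)"
  unfolding f_TT_def
proof (rule Greatest_equality)
  show "\<forall>F. feedback_arc_set A F \<longrightarrow> has_disjoint_TTs k F (n c - (k - 1))"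
    using assms unfolding midpoint_threshold_def
    by (intro allI impI disjoint_TTs_ge_class_size[OF A min, where a = a and
          d = "factor_threshold k (2 * a) + k"]) auto
  show "t \<le> n c - (k - 1)" if "\<forall>F. feedback_arc_set A F \<longrightarrow> has_disjoint_TTs k F t" for t
    using that by (intro disjoint_TTs_le_class_size[OF A \<open>k \<ge> 2\<close> \<open>c < k\<close>]) blast
qed

section \<open>Choice of parameters\<close>

definition subexponential :: "(nat \<Rightarrow> nat) \<Rightarrow> bool" where
  "subexponential f \<longleftrightarrow> (\<forall>c>1. (\<lambda>l. real (f l)) \<in> o(\<lambda>l. c ^ l))"

lemma subexponential_const: "subexponential (\<lambda>l. a)"
  unfolding subexponential_def by (intro allI impI) real_asymp

lemma subexponential_id: "subexponential (\<lambda>l. l)"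
  unfolding subexponential_def by (intro allI impI) real_asymp

lemma subexponential_add:
  "subexponential f \<Longrightarrow> subexponential g \<Longrightarrow> subexponential (\<lambda>l. f l + g l)"
  unfolding subexponential_def by (auto intro: sum_in_smallo)

lemma subexponential_mult:
  assumes "subexponential f" "subexponential g"
  shows "subexponential (\<lambda>l. f l * g l)"
  unfolding subexponential_def
proof (intro allI impI)
  fix c :: real assume "c > 1"
  then have "(\<lambda>l. real (f l) * real (g l)) \<in> o(\<lambda>l. sqrt c ^ l * sqrt c ^ l)"
    using assms unfolding subexponential_def by (intro landau_o.small.mult) auto
  then show "(\<lambda>l. real (f l * g l)) \<in> o(\<lambda>l. c ^ l)"
    using \<open>c > 1\<close> by (simp flip: power_mult_distrib)
qed

lemma subexponential_power: "subexponential f \<Longrightarrow> subexponential (\<lambda>l. f l ^ j)"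
  by (induction j) (simp_all add: subexponential_const subexponential_mult)

lemma subexponential_le_power_2:
  assumes "subexponential f"
  shows "eventually (\<lambda>l. f l \<le> 2 ^ l) sequentially"
proof -
  have "(\<lambda>l. real (f l)) \<in> o(\<lambda>l. 2 ^ l)" using assms unfolding subexponential_def by simp
  from landau_o.smallD[OF this, of 1] have "eventually (\<lambda>l. real (f l) \<le> real (2 ^ l)) sequentially"
    by simp
  then show ?thesis by (simp only: of_nat_le_iff)
qed

lemma subexponential_midpoint_threshold:
  assumes "subexponential f"
  shows "subexponential (\<lambda>l. midpoint_threshold k (f l))"
  unfolding midpoint_threshold_def factor_threshold_def absorber_threshold_def absorbing_set_size_def
    reservoir_size_def clique_threshold_def Let_def
  by (intro subexponential_add subexponential_mult subexponential_power subexponential_const assms)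

text \<open>If m < 2 ^ l and m is at least this threshold, then sets of size 3 * l with all edges directed
  one way and pairs of vertices with fewer than d midpoints exist only with probability O(1 / m).\<close>

definition size_threshold :: "nat \<Rightarrow> nat \<Rightarrow> nat" where
  "size_threshold k l = (let d = midpoint_threshold k (3 * l) in d + 3 * l * (d + 3))"

lemma ex_size_threshold_le:
  "\<exists>N>0. \<forall>m\<ge>N. \<exists>l. m < 2 ^ l \<and> size_threshold k l \<le> m"
proof -
  have "subexponential (\<lambda>l. size_threshold k (l + 1))"
    unfolding size_threshold_def Let_def
    by (intro subexponential_add subexponential_mult subexponential_midpoint_threshold
        subexponential_const subexponential_id)
  then obtain l0 where l0: "\<And>l. l \<ge> l0 \<Longrightarrow> size_threshold k (l + 1) \<le> 2 ^ l"
    using subexponential_le_power_2 unfolding eventually_sequentially by blast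
  have "\<exists>l. m < 2 ^ l \<and> size_threshold k l \<le> m" if m: "2 ^ l0 \<le> m" for m
  proof -
    have "1 \<le> m" using m by (rule order_trans[rotated]) simp
    then obtain l where l: "2 ^ l \<le> m" "m < 2 ^ (l + 1)" using ex_power_ivl1[of 2 m] by auto
    have "(2::nat) ^ l0 < 2 ^ (l + 1)" using m l(2) by linarith
    then have "l0 < l + 1" by (rule power_less_imp_less_exp[rotated]) simp
    then show ?thesis using l0[of l] l by (intro exI[of _ "l + 1"]) simp
  qed
  then show ?thesis by (intro exI[of _ "2 ^ l0"]) simp
qed

lemma power_mult_half_power_le:
  fixes m :: real
  assumes "0 < m" "m \<le> 2 ^ l" "i < j"
  shows "m ^ i * ((1 / 2) ^ l) ^ j \<le> 1 / m"
proof -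
  have half_power: "(1 / 2) ^ l \<le> 1 / m" using assms(1,2) by (simp add: field_simps)
  have "((1 / 2) ^ l :: real) ^ j \<le> ((1 / 2) ^ l) ^ (i + 1)"
    using assms(3) by (intro power_decreasing) (auto simp: power_le_one)
  also have "\<dots> \<le> (1 / m) ^ (i + 1)" using half_power by (intro power_mono) auto
  finally have "m ^ i * ((1 / 2) ^ l) ^ j \<le> m ^ i * (1 / m) ^ (i + 1)"
    using assms(1) by (intro mult_left_mono) auto
  also have "\<dots> = 1 / m" using assms(1) by (simp add: power_one_over field_simps)
  finally show ?thesis .
qed

lemma prob_unidirectional_le_inverse:
  assumes "\<And>i. i < k \<Longrightarrow> m \<le> n i" "0 < m" "0 < l" "real m \<le> 2 ^ l"
  shows "kp_prob k n {A. unidirectional k m (3 * l) A} \<le> real k ^ 2 / real m"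
proof -
  have "real m ^ (2 * (3 * l)) * ((1 / 2) ^ l) ^ (9 * l) \<le> 1 / real m"
    using assms(2-4) by (intro power_mult_half_power_le) auto
  also have "((1 / 2 :: real) ^ l) ^ (9 * l) = (1 / 2) ^ (3 * l * (3 * l))"
    by (simp add: ac_simps flip: power_mult)
  finally have "real k ^ 2 * (real m ^ (2 * (3 * l)) * (1 / 2) ^ (3 * l * (3 * l)))
      \<le> real k ^ 2 * (1 / real m)"
    by (rule mult_left_mono) simp
  from order_trans[OF prob_unidirectional_le[of k m n "3 * l", OF assms(1)] this]
  show ?thesis by simp
qed

lemma prob_few_midpoints_le_inverse:
  assumes "\<And>i. i < k \<Longrightarrow> m \<le> n i" "0 < m" "real m \<le> 2 ^ l" and d: "d + 3 * l * (d + 3) \<le> m"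
  shows "kp_prob k n {A. few_midpoints k m d A} \<le> real k ^ 3 / real m"
proof -
  have "(3 / 4 :: real) ^ (m - d) \<le> (3 / 4) ^ (3 * (l * (d + 3)))"
    using d by (intro power_decreasing) auto
  also have "\<dots> = ((3 / 4) ^ 3) ^ (l * (d + 3))" by (simp only: power_mult)
  also have "\<dots> \<le> (1 / 2) ^ (l * (d + 3))" by (intro power_mono) (auto simp: power3_eq_cube)
  finally have "real m ^ (d + 2) * (3 / 4) ^ (m - d) \<le> real m ^ (d + 2) * ((1 / 2) ^ l) ^ (d + 3)"
    by (intro mult_left_mono) (simp_all add: power_mult)
  also have "\<dots> \<le> 1 / real m"
    using assms(2,3) by (intro power_mult_half_power_le) auto
  finally have bound: "real k ^ 3 * (real m ^ (d + 2) * (3 / 4) ^ (m - d))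
      \<le> real k ^ 3 * (1 / real m)"
    by (rule mult_left_mono) simp
  have "d \<le> m" using d by simp
  from order_trans[OF prob_few_midpoints_le[of k m n d, OF assms(1) this] bound]
  show ?thesis by simp
qed

lemma prob_f_TT_ge:
  assumes "k \<ge> 2" "c < k" and min: "\<And>i. i < k \<Longrightarrow> n c \<le> n i"
    and pos: "0 < n c" and l: "n c < 2 ^ l" "size_threshold k l \<le> n c"
  shows "1 - (real k ^ 2 + real k ^ 3) / real (n c) \<le> kp_prob k n {A. f_TT k A = n c - (k - 1)}"
proof -
  let ?d = "midpoint_threshold k (3 * l)"
  let ?good = "{A. f_TT k A = n c - (k - 1)}"
  let ?U = "{A. unidirectional k (n c) (3 * l) A}" and ?M = "{A. few_midpoints k (n c) ?d A}"
  have d: "?d + 3 * l * (?d + 3) \<le> n c" using l(2) unfolding size_threshold_def Let_def .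
  have "l > 0" using pos l(1) by (cases l) auto
  have "real (n c) \<le> real (2 ^ l)" using l(1) by (intro of_nat_mono less_imp_le)
  then have "real (n c) \<le> 2 ^ l" by simp
  have "A \<in> ?U \<union> ?M" if "A \<in> kp_tournaments k n" "A \<notin> ?good" for A
    using f_TT_eq[OF that(1) assms(1,2) min, of "3 * l"] that(2) \<open>l > 0\<close> d by auto
  then have "kp_prob k n (- ?good) \<le> kp_prob k n (?U \<union> ?M)"
    by (intro measure_pmf.finite_measure_mono_AE)
      (auto simp: AE_measure_pmf_iff set_random_kp_tournament)
  also have "\<dots> \<le> kp_prob k n ?U + kp_prob k n ?M" by (rule measure_Un_le) auto
  also have "\<dots> \<le> real k ^ 2 / real (n c) + real k ^ 3 / real (n c)"
    using prob_unidirectional_le_inverse[OF min pos \<open>l > 0\<close> \<open>real (n c) \<le> 2 ^ l\<close>]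
      prob_few_midpoints_le_inverse[OF min pos \<open>real (n c) \<le> 2 ^ l\<close> d]
    by (rule add_mono)
  finally show ?thesis
    using measure_pmf.prob_compl[of ?good "random_kp_tournament k n"]
    by (simp add: Compl_eq_Diff_UNIV add_divide_distrib)
qed

lemma ex_class_size_prob_f_TT_ge:
  fixes \<epsilon> :: real
  assumes "k \<ge> 2" "\<epsilon> > 0"
  obtains N where "\<And>c n. c < k \<Longrightarrow> (\<And>i. i < k \<Longrightarrow> n c \<le> n i) \<Longrightarrow> N \<le> n c \<Longrightarrow>
    1 - \<epsilon> \<le> kp_prob k n {A. f_TT k A = n c - (k - 1)}"
proof -
  obtain N where N: "N > 0" "\<And>m. N \<le> m \<Longrightarrow> \<exists>l. m < 2 ^ l \<and> size_threshold k l \<le> m"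
    using ex_size_threshold_le by blast
  obtain M where M: "(real k ^ 2 + real k ^ 3) / \<epsilon> \<le> real M" using real_arch_simple by blast
  show thesis
  proof (rule that)
    fix c and n :: "nat \<Rightarrow> nat"
    assume c: "c < k" "\<And>i. i < k \<Longrightarrow> n c \<le> n i" and large: "N + M \<le> n c"
    obtain l where l: "n c < 2 ^ l" "size_threshold k l \<le> n c" using N(2)[of "n c"] large by auto
    have "(real k ^ 2 + real k ^ 3) / \<epsilon> \<le> real (n c)" using M large by linarith
    then have "1 - \<epsilon> \<le> 1 - (real k ^ 2 + real k ^ 3) / real (n c)"
      using \<open>\<epsilon> > 0\<close> large N(1) by (simp add: field_simps)
    also have "\<dots> \<le> kp_prob k n {A. f_TT k A = n c - (k - 1)}"
      using \<open>k \<ge> 2\<close> c large N(1) l by (intro prob_f_TT_ge) auto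
    finally show "1 - \<epsilon> \<le> kp_prob k n {A. f_TT k A = n c - (k - 1)}" .
  qed
qed

theorem theorem1:
  fixes k :: nat
  assumes "k \<ge> 2"
  shows "\<forall>\<epsilon>>0. \<exists>N. \<forall>n :: nat \<Rightarrow> nat.
           (\<forall>i<k. 0 < n i) \<and> (\<forall>i<k. n (k - 1) \<le> n i) \<and> N \<le> n (k - 1) \<longrightarrow>
           measure_pmf.prob (random_kp_tournament k n)
             {A. int (f_TT k A) = int (n (k - 1)) - int k + 1} \<ge> 1 - \<epsilon>"
proof (intro allI impI)
  fix \<epsilon> :: real assume "\<epsilon> > 0"
  obtain N where N: "\<And>c n. c < k \<Longrightarrow> (\<And>i. i < k \<Longrightarrow> n c \<le> n i) \<Longrightarrow> N \<le> n c \<Longrightarrow>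
      1 - \<epsilon> \<le> kp_prob k n {A. f_TT k A = n c - (k - 1)}"
    using ex_class_size_prob_f_TT_ge[OF assms \<open>\<epsilon> > 0\<close>] by blast
  have "1 - \<epsilon> \<le> kp_prob k n {A. int (f_TT k A) = int (n (k - 1)) - int k + 1}"
    if "\<forall>i<k. n (k - 1) \<le> n i" and "N + k \<le> n (k - 1)" for n
  proof -
    have "1 - \<epsilon> \<le> kp_prob k n {A. f_TT k A = n (k - 1) - (k - 1)}"
      using that assms by (intro N) auto
    also have "{A. f_TT k A = n (k - 1) - (k - 1)} =
        {A. int (f_TT k A) = int (n (k - 1)) - int k + 1}"
      using that(2) assms by (auto simp: of_nat_diff)
    finally show ?thesis .
  qed
  then show "\<exists>N. \<forall>n :: nat \<Rightarrow> nat.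
           (\<forall>i<k. 0 < n i) \<and> (\<forall>i<k. n (k - 1) \<le> n i) \<and> N \<le> n (k - 1) \<longrightarrow>
           measure_pmf.prob (random_kp_tournament k n)
             {A. int (f_TT k A) = int (n (k - 1)) - int k + 1} \<ge> 1 - \<epsilon>" by blast
qed

end
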